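(* Let $\mathcal C$ be a cartesian closed category with dependence (CCCwD), $\Gamma\in\mathcal C$ and $B\in\mathscr D_{\mathcal C}(\Gamma)$. Then there are functors $\_\{\pi_1^{\Gamma.B}\}:\mathcal C_\Gamma\to\mathcal C_{\Gamma.B}$, $\Sigma(B,\_):\mathcal C_{\Gamma.B}\to\mathcal C_\Gamma$ and $\Pi(B,\_):\mathcal C_{\Gamma.B}\to\mathcal C_\Gamma$ given by $$A\mapsto A\{\pi_1^{\Gamma.B}\},\quad g\in\mathscr D(\Gamma.A,A'\{\pi_1\})\mapsto g\{\langle\pi_1\circ\pi_1,\pi_2\rangle\};$$ $$C\mapsto\Sigma(B,C),\quad h\in\mathscr D(\Gamma.B.C,C'\{\pi_1\})\mapsto[\varpi_1,h\{\mathrm{Pair}_{B,C}^{-1}\}];$$ $$C\mapsto\Pi(B,C),\quad f\in\mathscr D(\Gamma.B.C,C'\{\pi_1\})\mapsto\Lambda_{\Pi(B,C')\{\pi_1\}}\bigl(f\{\langle\langle\pi_1\circ\pi_1,\pi_2\rangle,\mathrm{dev}_{\Pi(B,C)}\rangle\}\bigr),$$ and there are adjunctions $$\Sigma(B,\_)\dashv\_\{\pi_1^{\Gamma.B}\}\dashv\Pi(B,\_).$$ Consequently there is an adjunction $\Sigma(B,\_)\{\pi_1^{\Gamma.B}\}\dashv\Pi(B,\_\{\pi_1^{\Gamma.B}\})$ between $\mathcal C_{\Gamma.B}$ and itself.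
   Context: A category with dependence (CwD) is a category $\mathcal C$ with: for each object $\Gamma$ a class $\mathscr D_{\mathcal C}(\Gamma)$ of D-objects over $\Gamma$; for each $\Gamma$, $A\in\mathscr D_{\mathcal C}(\Gamma)$ a class $\mathscr D_{\mathcal C}(\Gamma,A)$ of D-morphisms from $\Gamma$ to $A$; for each morphism $\phi:\Delta\to\Gamma$ functions $\_\{\phi\}:\mathscr D(\Gamma)\to\mathscr D(\Delta)$ and $\_\{\phi\}:\mathscr D(\Gamma,A)\to\mathscr D(\Delta,A\{\phi\})$ with $A\{\mathrm{id}\}=A$, $a\{\mathrm{id}\}=a$, $A\{\phi\circ\varphi\}=A\{\phi\}\{\varphi\}$, $a\{\phi\circ\varphi\}=a\{\phi\}\{\varphi\}$. A semi-$\Sigma$-space of $\Gamma$ and $A\in\mathscr D(\Gamma)$ is an object $\Gamma.A$ with $\pi_1:\Gamma.A\to\Gamma$ and $\pi_2\in\mathscr D(\Gamma.A,A\{\pi_1\})$ such that for all $\phi:\Delta\to\Gamma$ and $g\in\mathscr D(\Delta,A\{\phi\})$ there is a unique $\langle\phi,g\rangle:\Delta\to\Gamma.A$ with $\pi_1\circ\langle\phi,g\rangle=\phi$ and $\pi_2\{\langle\phi,g\rangle\}=g$. An SCCwD is a CwD that has a terminal object and a semi-$\Sigma$-space of every $\Gamma$ and $A$. $\Gamma.A.B$ means $(\Gamma.A).B$. For $\phi:\Delta\to\Gamma$, $A\in\mathscr D(\Gamma)$ put $\phi^{+A}=\langle\phi\circ\pi_1,\pi_2\rangle:\Delta.A\{\phi\}\to\Gamma.A$;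 $\overline a=\langle\mathrm{id}_\Gamma,a\rangle$ for $a\in\mathscr D(\Gamma,A)$. $\mathcal C_\Gamma$ is the category with objects the D-objects over $\Gamma$, morphisms $\mathcal C_\Gamma(A,B)=\mathscr D(\Gamma.A,B\{\pi_1\})$, composition $g\circ f=g\{\langle\pi_1,f\rangle\}$, identities $\pi_2$. A unit D-object is $1\in\mathscr D(T)$, $T$ terminal, with $\mathscr D(\Gamma,1\{!_\Gamma\})$ a singleton for every $\Gamma$. A $\Sigma$-space of $A\in\mathscr D(\Gamma)$, $B\in\mathscr D(\Gamma.A)$ is $\Sigma(A,B)\in\mathscr D(\Gamma)$ with $\varpi_1\in\mathscr D(\Gamma.\Sigma(A,B),A\{\pi_1\})$, $\varpi_2\in\mathscr D(\Gamma.\Sigma(A,B),B\{\langle\pi_1,\varpi_1\rangle\})$ such that for any $\phi:\Delta\to\Gamma$, $g\in\mathscr D(\Delta,A\{\phi\})$, $h\in\mathscr D(\Delta,B\{\langle\phi,g\rangle\})$ there is a unique $[g,h]\in\mathscr D(\Delta,\Sigma(A,B)\{\phi\})$ with $\varpi_1\{\langle\phi,[g,h]\rangle\}=g$, $\varpi_2\{\langle\phi,[g,h]\rangle\}=h$. $\mathrm{Pair}_{A,B}=\langle\pi_1\circ\pi_1,[\pi_2\{\pi_1\},\pi_2]\rangle:\Gamma.A.B\to\Gamma.\Sigma(A,B)$ has inverse $\langle\langle\pi_1,\varpi_1\rangle,\varpi_2\rangle$. A pseudo-$\Pi$-space from $A\in\mathscr D(\Gamma)$ to $B\in\mathscr D(\Gamma.A)$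 is $\Pi(A,B)\in\mathscr D(\Gamma)$ with $\mathrm{dev}_{\Pi(A,B)}\in\mathscr D(\Gamma.\Pi(A,B).A\{\pi_1\},B\{\pi_1^{+A}\})$ such that for each $f\in\mathscr D(\Gamma.A,B)$ there is a unique $\Lambda(f)\in\mathscr D(\Gamma,\Pi(A,B))$ with $\mathrm{dev}\{(\overline{\Lambda(f)})^{+A\{\pi_1\}}\}=f$. It is a $\Pi$-space iff for every $C\in\mathscr D(\Gamma)$, with $p=\pi_1^{\Gamma.C}$, $\Pi(A,B)\{p\}$ with $\mathrm{dev}\{(p^{+\Pi(A,B)})^{+A\{\pi_1\}}\}$ is a pseudo-$\Pi$-space from $A\{p\}$ to $B\{p^{+A}\}$ (currying $\Lambda_{\Pi(A,B)\{p\}}$, briefly $\Lambda_C$), and for any $D\in\mathscr D(\Gamma)$, $h\in\mathscr D(\Gamma.C.A\{p\},B\{p^{+A}\})$, $g\in\mathscr D(\Gamma.D,C\{\pi_1\})$: $\mathrm{dev}\{\langle p,\Lambda_C(h)\rangle^{+A\{\pi_1\}}\}=h$ and $\Lambda_D(h\{\langle\pi_1,g\rangle^{+A\{p\}}\})=\Lambda_C(h)\{\langle\pi_1,g\rangle\}$. A CCCwD is an SCCwD that has a unit D-object, a $\Sigma$-space of every $A,B$ and a $\Pi$-space from every $A$ to every $B$ (choices of these are fixed).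
   Formalization: In the final adjunction the right adjoint is taken to be Π(B,_){π₁} instead of the printed Π(B,_{π₁}), which is not defined on the category over Γ.B since objects over Γ.B cannot be substituted along π₁: Γ.B → Γ. *)

theory Defs
  imports Main
begin

section \<open>Categories, functors, adjunctions\<close>

text \<open>
  Hom-sets are families indexed by their source and target and are not assumed to be disjoint:
  in the categories of D-objects below, the same D-morphism may inhabit several of them.  This is
  why composition, the action of functors on morphisms, and the substitution operations all carry
  the objects involved as explicit arguments.  The arrow \<open>cmp C X Y Z g f\<close> is the composite of
  \<open>f : X \<rightarrow> Y\<close> followed by \<open>g : Y \<rightarrow> Z\<close>.
\<close>

record ('o, 'm) category =
  obj :: "'o set"
  hom :: "'o \<Rightarrow> 'o \<Rightarrow> 'm set"
  ide :: "'o \<Rightarrow> 'm"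
  cmp :: "'o \<Rightarrow> 'o \<Rightarrow> 'o \<Rightarrow> 'm \<Rightarrow> 'm \<Rightarrow> 'm"

locale category =
  fixes C :: "('o, 'm, 'z) category_scheme"
  assumes ide_in_hom: "X \<in> obj C \<Longrightarrow> ide C X \<in> hom C X X"
    and cmp_in_hom: "\<lbrakk>X \<in> obj C; Y \<in> obj C; Z \<in> obj C; f \<in> hom C X Y; g \<in> hom C Y Z\<rbrakk>
      \<Longrightarrow> cmp C X Y Z g f \<in> hom C X Z"
    and cmp_ide_left: "\<lbrakk>X \<in> obj C; Y \<in> obj C; f \<in> hom C X Y\<rbrakk>
      \<Longrightarrow> cmp C X Y Y (ide C Y) f = f"
    and cmp_ide_right: "\<lbrakk>X \<in> obj C; Y \<in> obj C; f \<in> hom C X Y\<rbrakk>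
      \<Longrightarrow> cmp C X X Y f (ide C X) = f"
    and cmp_assoc: "\<lbrakk>W \<in> obj C; X \<in> obj C; Y \<in> obj C; Z \<in> obj C;
        f \<in> hom C W X; g \<in> hom C X Y; h \<in> hom C Y Z\<rbrakk>
      \<Longrightarrow> cmp C W X Z (cmp C X Y Z h g) f = cmp C W Y Z h (cmp C W X Y g f)"

definition inverse_mor :: "('o, 'm, 'z) category_scheme \<Rightarrow> 'o \<Rightarrow> 'o \<Rightarrow> 'm \<Rightarrow> 'm" where
  "inverse_mor C X Y f = (THE g. g \<in> hom C Y X \<and>
     cmp C X Y X g f = ide C X \<and> cmp C Y X Y f g = ide C Y)"

record ('o1, 'm1, 'o2, 'm2) functor_data =
  fobj :: "'o1 \<Rightarrow> 'o2"
  fmor :: "'o1 \<Rightarrow> 'o1 \<Rightarrow> 'm1 \<Rightarrow> 'm2"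

definition is_functor ::
  "('o1, 'm1, 'y) category_scheme \<Rightarrow> ('o2, 'm2, 'z) category_scheme \<Rightarrow>
   ('o1, 'm1, 'o2, 'm2) functor_data \<Rightarrow> bool" where
  "is_functor C D F \<longleftrightarrow>
     category C \<and> category D \<and>
     (\<forall>X \<in> obj C. fobj F X \<in> obj D) \<and>
     (\<forall>X \<in> obj C. \<forall>Y \<in> obj C. \<forall>f \<in> hom C X Y. fmor F X Y f \<in> hom D (fobj F X) (fobj F Y)) \<and>
     (\<forall>X \<in> obj C. fmor F X X (ide C X) = ide D (fobj F X)) \<and>
     (\<forall>X \<in> obj C. \<forall>Y \<in> obj C. \<forall>Z \<in> obj C. \<forall>f \<in> hom C X Y. \<forall>g \<in> hom C Y Z.
        fmor F X Z (cmp C X Y Z g f) =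
        cmp D (fobj F X) (fobj F Y) (fobj F Z) (fmor F Y Z g) (fmor F X Y f))"

definition functor_comp ::
  "('o2, 'm2, 'o3, 'm3) functor_data \<Rightarrow> ('o1, 'm1, 'o2, 'm2) functor_data \<Rightarrow>
   ('o1, 'm1, 'o3, 'm3) functor_data" where
  "functor_comp G F =
     \<lparr>fobj = (\<lambda>X. fobj G (fobj F X)),
      fmor = (\<lambda>X Y f. fmor G (fobj F X) (fobj F Y) (fmor F X Y f))\<rparr>"

text \<open>
  \<open>adjoint C D F G\<close>: the functor \<open>F : C \<rightarrow> D\<close> is left adjoint to \<open>G : D \<rightarrow> C\<close>, by bijections
  \<open>D(F X, Y) \<rightarrow> C(X, G Y)\<close> natural in \<open>X\<close> and \<open>Y\<close>.
\<close>

definition adjoint ::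
  "('o1, 'm1, 'y) category_scheme \<Rightarrow> ('o2, 'm2, 'z) category_scheme \<Rightarrow>
   ('o1, 'm1, 'o2, 'm2) functor_data \<Rightarrow> ('o2, 'm2, 'o1, 'm1) functor_data \<Rightarrow> bool" where
  "adjoint C D F G \<longleftrightarrow>
     is_functor C D F \<and> is_functor D C G \<and>
     (\<exists>\<Phi> :: 'o1 \<Rightarrow> 'o2 \<Rightarrow> 'm2 \<Rightarrow> 'm1.
        (\<forall>X \<in> obj C. \<forall>Y \<in> obj D.
           bij_betw (\<Phi> X Y) (hom D (fobj F X) Y) (hom C X (fobj G Y))) \<and>
        (\<forall>X \<in> obj C. \<forall>X' \<in> obj C. \<forall>Y \<in> obj D. \<forall>Y' \<in> obj D.
         \<forall>u \<in> hom C X' X. \<forall>v \<in> hom D Y Y'. \<forall>k \<in> hom D (fobj F X) Y.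
           \<Phi> X' Y' (cmp D (fobj F X') Y Y' v (cmp D (fobj F X') (fobj F X) Y k (fmor F X' X u))) =
           cmp C X' (fobj G Y) (fobj G Y') (fmor G Y Y' v) (cmp C X' X (fobj G Y) (\<Phi> X Y k) u)))"


section \<open>Categories with dependence\<close>

text \<open>
  For \<open>\<phi> : \<Delta> \<rightarrow> \<Gamma>\<close>, \<open>osub C \<Delta> \<Gamma> \<phi> A\<close> is \<open>A{\<phi>}\<close> and \<open>msub C \<Delta> \<Gamma> \<phi> A a\<close> is \<open>a{\<phi>}\<close> for
  \<open>a \<in> dmor C \<Gamma> A\<close>.
\<close>

record ('o, 'm, 'd, 'e) cwd = "('o, 'm) category" +
  dobj :: "'o \<Rightarrow> 'd set"
  dmor :: "'o \<Rightarrow> 'd \<Rightarrow> 'e set"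
  osub :: "'o \<Rightarrow> 'o \<Rightarrow> 'm \<Rightarrow> 'd \<Rightarrow> 'd"
  msub :: "'o \<Rightarrow> 'o \<Rightarrow> 'm \<Rightarrow> 'd \<Rightarrow> 'e \<Rightarrow> 'e"

locale cwd = category C for C :: "('o, 'm, 'd, 'e, 'z) cwd_scheme" +
  assumes osub_in: "\<lbrakk>\<Delta> \<in> obj C; \<Gamma> \<in> obj C; \<phi> \<in> hom C \<Delta> \<Gamma>; A \<in> dobj C \<Gamma>\<rbrakk>
      \<Longrightarrow> osub C \<Delta> \<Gamma> \<phi> A \<in> dobj C \<Delta>"
    and msub_in: "\<lbrakk>\<Delta> \<in> obj C; \<Gamma> \<in> obj C; \<phi> \<in> hom C \<Delta> \<Gamma>; A \<in> dobj C \<Gamma>; a \<in> dmor C \<Gamma> A\<rbrakk>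
      \<Longrightarrow> msub C \<Delta> \<Gamma> \<phi> A a \<in> dmor C \<Delta> (osub C \<Delta> \<Gamma> \<phi> A)"
    and osub_ide: "\<lbrakk>\<Gamma> \<in> obj C; A \<in> dobj C \<Gamma>\<rbrakk> \<Longrightarrow> osub C \<Gamma> \<Gamma> (ide C \<Gamma>) A = A"
    and msub_ide: "\<lbrakk>\<Gamma> \<in> obj C; A \<in> dobj C \<Gamma>; a \<in> dmor C \<Gamma> A\<rbrakk>
      \<Longrightarrow> msub C \<Gamma> \<Gamma> (ide C \<Gamma>) A a = a"
    and osub_cmp: "\<lbrakk>\<Theta> \<in> obj C; \<Delta> \<in> obj C; \<Gamma> \<in> obj C;
        \<psi> \<in> hom C \<Theta> \<Delta>; \<phi> \<in> hom C \<Delta> \<Gamma>; A \<in> dobj C \<Gamma>\<rbrakk>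
      \<Longrightarrow> osub C \<Theta> \<Gamma> (cmp C \<Theta> \<Delta> \<Gamma> \<phi> \<psi>) A = osub C \<Theta> \<Delta> \<psi> (osub C \<Delta> \<Gamma> \<phi> A)"
    and msub_cmp: "\<lbrakk>\<Theta> \<in> obj C; \<Delta> \<in> obj C; \<Gamma> \<in> obj C;
        \<psi> \<in> hom C \<Theta> \<Delta>; \<phi> \<in> hom C \<Delta> \<Gamma>; A \<in> dobj C \<Gamma>; a \<in> dmor C \<Gamma> A\<rbrakk>
      \<Longrightarrow> msub C \<Theta> \<Gamma> (cmp C \<Theta> \<Delta> \<Gamma> \<phi> \<psi>) A a =
          msub C \<Theta> \<Delta> \<psi> (osub C \<Delta> \<Gamma> \<phi> A) (msub C \<Delta> \<Gamma> \<phi> A a)"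
begin

text \<open>\<open>(E, p, q)\<close> plays the role of \<open>(\<Gamma>.A, \<pi>\<^sub>1, \<pi>\<^sub>2)\<close>.\<close>

definition is_semi_sigma :: "'o \<Rightarrow> 'd \<Rightarrow> 'o \<Rightarrow> 'm \<Rightarrow> 'e \<Rightarrow> bool" where
  "is_semi_sigma \<Gamma> A E p q \<longleftrightarrow>
     E \<in> obj C \<and> p \<in> hom C E \<Gamma> \<and> q \<in> dmor C E (osub C E \<Gamma> p A) \<and>
     (\<forall>\<Delta> \<in> obj C. \<forall>\<phi> \<in> hom C \<Delta> \<Gamma>. \<forall>g \<in> dmor C \<Delta> (osub C \<Delta> \<Gamma> \<phi> A).
        \<exists>!u. u \<in> hom C \<Delta> E \<and> cmp C \<Delta> E \<Gamma> p u = \<phi> \<and> msub C \<Delta> E u (osub C E \<Gamma> p A) q = g)"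

end

record ('o, 'm, 'd, 'e) sccwd = "('o, 'm, 'd, 'e) cwd" +
  terminal :: "'o"
  ext :: "'o \<Rightarrow> 'd \<Rightarrow> 'o"
  pr1 :: "'o \<Rightarrow> 'd \<Rightarrow> 'm"
  pr2 :: "'o \<Rightarrow> 'd \<Rightarrow> 'e"

locale sccwd = cwd C for C :: "('o, 'm, 'd, 'e, 'z) sccwd_scheme" +
  assumes terminal_in: "terminal C \<in> obj C"
    and terminal_unique: "\<Gamma> \<in> obj C \<Longrightarrow> \<exists>!f. f \<in> hom C \<Gamma> (terminal C)"
    and semi_sigma: "\<lbrakk>\<Gamma> \<in> obj C; A \<in> dobj C \<Gamma>\<rbrakk>
      \<Longrightarrow> is_semi_sigma \<Gamma> A (ext C \<Gamma> A) (pr1 C \<Gamma> A) (pr2 C \<Gamma> A)"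
begin

definition bang :: "'o \<Rightarrow> 'm" where
  "bang \<Gamma> = (THE f. f \<in> hom C \<Gamma> (terminal C))"

text \<open>\<open>osub1 \<Gamma> X A\<close> is \<open>A{\<pi>\<^sub>1}\<close> with \<open>\<pi>\<^sub>1 : \<Gamma>.X \<rightarrow> \<Gamma>\<close>.\<close>

definition osub1 :: "'o \<Rightarrow> 'd \<Rightarrow> 'd \<Rightarrow> 'd" where
  "osub1 \<Gamma> X A = osub C (ext C \<Gamma> X) \<Gamma> (pr1 C \<Gamma> X) A"

text \<open>\<open>pair \<Delta> \<Gamma> A \<phi> g\<close> is \<open>\<langle>\<phi>,g\<rangle> : \<Delta> \<rightarrow> \<Gamma>.A\<close>.\<close>

definition pair :: "'o \<Rightarrow> 'o \<Rightarrow> 'd \<Rightarrow> 'm \<Rightarrow> 'e \<Rightarrow> 'm" where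
  "pair \<Delta> \<Gamma> A \<phi> g = (THE u. u \<in> hom C \<Delta> (ext C \<Gamma> A) \<and>
     cmp C \<Delta> (ext C \<Gamma> A) \<Gamma> (pr1 C \<Gamma> A) u = \<phi> \<and>
     msub C \<Delta> (ext C \<Gamma> A) u (osub1 \<Gamma> A A) (pr2 C \<Gamma> A) = g)"

text \<open>\<open>lift \<Delta> \<Gamma> A \<phi>\<close> is \<open>\<phi>\<^sup>+\<^sup>A = \<langle>\<phi> \<circ> \<pi>\<^sub>1, \<pi>\<^sub>2\<rangle> : \<Delta>.A{\<phi>} \<rightarrow> \<Gamma>.A\<close>.\<close>

definition lift :: "'o \<Rightarrow> 'o \<Rightarrow> 'd \<Rightarrow> 'm \<Rightarrow> 'm" where
  "lift \<Delta> \<Gamma> A \<phi> = (let A' = osub C \<Delta> \<Gamma> \<phi> A; E = ext C \<Delta> A' in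
     pair E \<Gamma> A (cmp C E \<Delta> \<Gamma> \<phi> (pr1 C \<Delta> A')) (pr2 C \<Delta> A'))"

text \<open>\<open>section_of \<Gamma> A a\<close> is \<open>\<langle>id, a\<rangle> : \<Gamma> \<rightarrow> \<Gamma>.A\<close>.\<close>

definition section_of :: "'o \<Rightarrow> 'd \<Rightarrow> 'e \<Rightarrow> 'm" where
  "section_of \<Gamma> A a = pair \<Gamma> \<Gamma> A (ide C \<Gamma>) a"

text \<open>The category \<open>C\<^sub>\<Gamma>\<close> of D-objects over \<open>\<Gamma>\<close>.\<close>

definition slice :: "'o \<Rightarrow> ('d, 'e) category" where
  "slice \<Gamma> =
     \<lparr>obj = dobj C \<Gamma>,
      hom = (\<lambda>A B. dmor C (ext C \<Gamma> A) (osub1 \<Gamma> A B)),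
      ide = (\<lambda>A. pr2 C \<Gamma> A),
      cmp = (\<lambda>X Y Z g f.
        msub C (ext C \<Gamma> X) (ext C \<Gamma> Y) (pair (ext C \<Gamma> X) \<Gamma> Y (pr1 C \<Gamma> X) f) (osub1 \<Gamma> Y Z) g)\<rparr>"

definition is_unit :: "'d \<Rightarrow> bool" where
  "is_unit U \<longleftrightarrow> U \<in> dobj C (terminal C) \<and>
     (\<forall>\<Gamma> \<in> obj C. \<exists>!u. u \<in> dmor C \<Gamma> (osub C \<Gamma> (terminal C) (bang \<Gamma>) U))"


subsection \<open>\<open>\<Sigma>\<close>-spaces\<close>

text \<open>
  \<open>(S, w\<^sub>1, w\<^sub>2)\<close> plays the role of the \<open>\<Sigma>\<close>-space of \<open>A\<close> and \<open>B\<close> with its projections;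
  \<open>is_dpair \<Delta> \<Gamma> A B S w\<^sub>1 w\<^sub>2 \<phi> g h k\<close> says that \<open>k\<close> satisfies the equations that characterize
  \<open>[g,h] \<in> dmor C \<Delta> (S{\<phi>})\<close>.
\<close>

definition is_dpair ::
  "'o \<Rightarrow> 'o \<Rightarrow> 'd \<Rightarrow> 'd \<Rightarrow> 'd \<Rightarrow> 'e \<Rightarrow> 'e \<Rightarrow> 'm \<Rightarrow> 'e \<Rightarrow> 'e \<Rightarrow> 'e \<Rightarrow> bool" where
  "is_dpair \<Delta> \<Gamma> A B S w1 w2 \<phi> g h k \<longleftrightarrow>
     k \<in> dmor C \<Delta> (osub C \<Delta> \<Gamma> \<phi> S) \<and>
     msub C \<Delta> (ext C \<Gamma> S) (pair \<Delta> \<Gamma> S \<phi> k) (osub1 \<Gamma> S A) w1 = g \<and>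
     msub C \<Delta> (ext C \<Gamma> S) (pair \<Delta> \<Gamma> S \<phi> k)
       (osub C (ext C \<Gamma> S) (ext C \<Gamma> A) (pair (ext C \<Gamma> S) \<Gamma> A (pr1 C \<Gamma> S) w1) B) w2 = h"

definition is_sigma :: "'o \<Rightarrow> 'd \<Rightarrow> 'd \<Rightarrow> 'd \<Rightarrow> 'e \<Rightarrow> 'e \<Rightarrow> bool" where
  "is_sigma \<Gamma> A B S w1 w2 \<longleftrightarrow>
     S \<in> dobj C \<Gamma> \<and>
     w1 \<in> dmor C (ext C \<Gamma> S) (osub1 \<Gamma> S A) \<and>
     w2 \<in> dmor C (ext C \<Gamma> S)
       (osub C (ext C \<Gamma> S) (ext C \<Gamma> A) (pair (ext C \<Gamma> S) \<Gamma> A (pr1 C \<Gamma> S) w1) B) \<and>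
     (\<forall>\<Delta> \<in> obj C. \<forall>\<phi> \<in> hom C \<Delta> \<Gamma>. \<forall>g \<in> dmor C \<Delta> (osub C \<Delta> \<Gamma> \<phi> A).
      \<forall>h \<in> dmor C \<Delta> (osub C \<Delta> (ext C \<Gamma> A) (pair \<Delta> \<Gamma> A \<phi> g) B).
        \<exists>!k. is_dpair \<Delta> \<Gamma> A B S w1 w2 \<phi> g h k)"


subsection \<open>\<open>\<Pi>\<close>-spaces\<close>

text \<open>
  \<open>(P, d)\<close> plays the role of a pseudo-\<open>\<Pi>\<close>-space from \<open>A\<close> to \<open>B\<close> with its \<open>dev\<close>;
  \<open>is_curry \<Gamma> A B P d f k\<close> says that \<open>k\<close> satisfies the equation that characterizes \<open>\<Lambda>(f)\<close>.
\<close>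

definition is_curry :: "'o \<Rightarrow> 'd \<Rightarrow> 'd \<Rightarrow> 'd \<Rightarrow> 'e \<Rightarrow> 'e \<Rightarrow> 'e \<Rightarrow> bool" where
  "is_curry \<Gamma> A B P d f k \<longleftrightarrow>
     k \<in> dmor C \<Gamma> P \<and>
     msub C (ext C \<Gamma> A) (ext C (ext C \<Gamma> P) (osub1 \<Gamma> P A))
       (lift \<Gamma> (ext C \<Gamma> P) (osub1 \<Gamma> P A) (section_of \<Gamma> P k))
       (osub C (ext C (ext C \<Gamma> P) (osub1 \<Gamma> P A)) (ext C \<Gamma> A)
         (lift (ext C \<Gamma> P) \<Gamma> A (pr1 C \<Gamma> P)) B) d = f"

definition is_pseudo_pi :: "'o \<Rightarrow> 'd \<Rightarrow> 'd \<Rightarrow> 'd \<Rightarrow> 'e \<Rightarrow> bool" where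
  "is_pseudo_pi \<Gamma> A B P d \<longleftrightarrow>
     P \<in> dobj C \<Gamma> \<and>
     d \<in> dmor C (ext C (ext C \<Gamma> P) (osub1 \<Gamma> P A))
       (osub C (ext C (ext C \<Gamma> P) (osub1 \<Gamma> P A)) (ext C \<Gamma> A)
         (lift (ext C \<Gamma> P) \<Gamma> A (pr1 C \<Gamma> P)) B) \<and>
     (\<forall>f \<in> dmor C (ext C \<Gamma> A) B. \<exists>!k. is_curry \<Gamma> A B P d f k)"

text \<open>
  With \<open>p = \<pi>\<^sub>1 : \<Gamma>.X \<rightarrow> \<Gamma>\<close>: \<open>wk_cod \<Gamma> X A B\<close> is \<open>B{p\<^sup>+\<^sup>A}\<close>, \<open>wk_dev \<Gamma> X A B P d\<close> is
  \<open>d{(p\<^sup>+\<^sup>P)\<^sup>+}\<close> where the outer lift is along \<open>A{\<pi>\<^sub>1}\<close>, and \<open>wk_curry \<Gamma> X A B P d\<close> is the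
  currying operation \<open>\<Lambda>\<^sub>X\<close> of the pseudo-\<open>\<Pi>\<close>-space \<open>P{p}\<close> from \<open>A{p}\<close> to \<open>B{p\<^sup>+\<^sup>A}\<close>.
\<close>

definition wk_cod :: "'o \<Rightarrow> 'd \<Rightarrow> 'd \<Rightarrow> 'd \<Rightarrow> 'd" where
  "wk_cod \<Gamma> X A B = osub C (ext C (ext C \<Gamma> X) (osub1 \<Gamma> X A)) (ext C \<Gamma> A)
     (lift (ext C \<Gamma> X) \<Gamma> A (pr1 C \<Gamma> X)) B"

definition wk_dev :: "'o \<Rightarrow> 'd \<Rightarrow> 'd \<Rightarrow> 'd \<Rightarrow> 'd \<Rightarrow> 'e \<Rightarrow> 'e" where
  "wk_dev \<Gamma> X A B P d = (let
       p = pr1 C \<Gamma> X;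
       pP = lift (ext C \<Gamma> X) \<Gamma> P p;
       E = ext C (ext C \<Gamma> X) (osub1 \<Gamma> X P)
     in msub C (ext C E (osub C E (ext C \<Gamma> P) pP (osub1 \<Gamma> P A))) (ext C (ext C \<Gamma> P) (osub1 \<Gamma> P A))
          (lift E (ext C \<Gamma> P) (osub1 \<Gamma> P A) pP) (wk_cod \<Gamma> P A B) d)"

definition wk_curry :: "'o \<Rightarrow> 'd \<Rightarrow> 'd \<Rightarrow> 'd \<Rightarrow> 'd \<Rightarrow> 'e \<Rightarrow> 'e \<Rightarrow> 'e" where
  "wk_curry \<Gamma> X A B P d h =
     (THE k. is_curry (ext C \<Gamma> X) (osub1 \<Gamma> X A) (wk_cod \<Gamma> X A B) (osub1 \<Gamma> X P)
        (wk_dev \<Gamma> X A B P d) h k)"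

definition is_pi :: "'o \<Rightarrow> 'd \<Rightarrow> 'd \<Rightarrow> 'd \<Rightarrow> 'e \<Rightarrow> bool" where
  "is_pi \<Gamma> A B P d \<longleftrightarrow>
     is_pseudo_pi \<Gamma> A B P d \<and>
     (\<forall>X \<in> dobj C \<Gamma>.
        is_pseudo_pi (ext C \<Gamma> X) (osub1 \<Gamma> X A) (wk_cod \<Gamma> X A B) (osub1 \<Gamma> X P)
          (wk_dev \<Gamma> X A B P d) \<and>
        (\<forall>Y \<in> dobj C \<Gamma>.
         \<forall>h \<in> dmor C (ext C (ext C \<Gamma> X) (osub1 \<Gamma> X A)) (wk_cod \<Gamma> X A B).
         \<forall>g \<in> dmor C (ext C \<Gamma> Y) (osub1 \<Gamma> Y X).
           msub C (ext C (ext C \<Gamma> X) (osub1 \<Gamma> X A)) (ext C (ext C \<Gamma> P) (osub1 \<Gamma> P A))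
             (lift (ext C \<Gamma> X) (ext C \<Gamma> P) (osub1 \<Gamma> P A)
               (pair (ext C \<Gamma> X) \<Gamma> P (pr1 C \<Gamma> X) (wk_curry \<Gamma> X A B P d h)))
             (wk_cod \<Gamma> P A B) d = h \<and>
           (let s = pair (ext C \<Gamma> Y) \<Gamma> X (pr1 C \<Gamma> Y) g in
              wk_curry \<Gamma> Y A B P d
                (msub C (ext C (ext C \<Gamma> Y) (osub1 \<Gamma> Y A)) (ext C (ext C \<Gamma> X) (osub1 \<Gamma> X A))
                  (lift (ext C \<Gamma> Y) (ext C \<Gamma> X) (osub1 \<Gamma> X A) s) (wk_cod \<Gamma> X A B) h) =
              msub C (ext C \<Gamma> Y) (ext C \<Gamma> X) s (osub1 \<Gamma> X P) (wk_curry \<Gamma> X A B P d h))))"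

end


section \<open>Cartesian closed categories with dependence\<close>

record ('o, 'm, 'd, 'e) cccwd = "('o, 'm, 'd, 'e) sccwd" +
  unit_dobj :: "'d"
  SigmaD :: "'o \<Rightarrow> 'd \<Rightarrow> 'd \<Rightarrow> 'd"
  spr1 :: "'o \<Rightarrow> 'd \<Rightarrow> 'd \<Rightarrow> 'e"
  spr2 :: "'o \<Rightarrow> 'd \<Rightarrow> 'd \<Rightarrow> 'e"
  PiD :: "'o \<Rightarrow> 'd \<Rightarrow> 'd \<Rightarrow> 'd"
  dev :: "'o \<Rightarrow> 'd \<Rightarrow> 'd \<Rightarrow> 'e"

locale cccwd = sccwd C for C :: "('o, 'm, 'd, 'e, 'z) cccwd_scheme" +
  assumes unit: "is_unit (unit_dobj C)"
    and sigma: "\<lbrakk>\<Gamma> \<in> obj C; A \<in> dobj C \<Gamma>; B \<in> dobj C (ext C \<Gamma> A)\<rbrakk>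
      \<Longrightarrow> is_sigma \<Gamma> A B (SigmaD C \<Gamma> A B) (spr1 C \<Gamma> A B) (spr2 C \<Gamma> A B)"
    and pi: "\<lbrakk>\<Gamma> \<in> obj C; A \<in> dobj C \<Gamma>; B \<in> dobj C (ext C \<Gamma> A)\<rbrakk>
      \<Longrightarrow> is_pi \<Gamma> A B (PiD C \<Gamma> A B) (dev C \<Gamma> A B)"
begin

text \<open>\<open>dpair \<Delta> \<Gamma> A B \<phi> g h\<close> is \<open>[g,h] \<in> dmor C \<Delta> (\<Sigma>(A,B){\<phi>})\<close>.\<close>

definition dpair :: "'o \<Rightarrow> 'o \<Rightarrow> 'd \<Rightarrow> 'd \<Rightarrow> 'm \<Rightarrow> 'e \<Rightarrow> 'e \<Rightarrow> 'e" where
  "dpair \<Delta> \<Gamma> A B \<phi> g h =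
     (THE k. is_dpair \<Delta> \<Gamma> A B (SigmaD C \<Gamma> A B) (spr1 C \<Gamma> A B) (spr2 C \<Gamma> A B) \<phi> g h k)"

text \<open>\<open>pair_iso \<Gamma> A B : \<Gamma>.A.B \<rightarrow> \<Gamma>.\<Sigma>(A,B)\<close> is \<open>\<langle>\<pi>\<^sub>1 \<circ> \<pi>\<^sub>1, [\<pi>\<^sub>2{\<pi>\<^sub>1}, \<pi>\<^sub>2]\<rangle>\<close>.\<close>

definition pair_iso :: "'o \<Rightarrow> 'd \<Rightarrow> 'd \<Rightarrow> 'm" where
  "pair_iso \<Gamma> A B = (let
       GA = ext C \<Gamma> A;
       GAB = ext C GA B;
       q = cmp C GAB GA \<Gamma> (pr1 C \<Gamma> A) (pr1 C GA B)
     in pair GAB \<Gamma> (SigmaD C \<Gamma> A B) q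
          (dpair GAB \<Gamma> A B q (msub C GAB GA (pr1 C GA B) (osub1 \<Gamma> A A) (pr2 C \<Gamma> A)) (pr2 C GA B)))"

definition pair_iso_inv :: "'o \<Rightarrow> 'd \<Rightarrow> 'd \<Rightarrow> 'm" where
  "pair_iso_inv \<Gamma> A B =
     inverse_mor C (ext C (ext C \<Gamma> A) B) (ext C \<Gamma> (SigmaD C \<Gamma> A B)) (pair_iso \<Gamma> A B)"

text \<open>In \<open>weakening_functor\<close> and \<open>Pi_functor\<close>, the lift of \<open>\<pi>\<^sub>1\<close> is \<open>\<langle>\<pi>\<^sub>1 \<circ> \<pi>\<^sub>1, \<pi>\<^sub>2\<rangle>\<close>.\<close>

definition weakening_functor :: "'o \<Rightarrow> 'd \<Rightarrow> ('d, 'e, 'd, 'e) functor_data" where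
  "weakening_functor \<Gamma> B =
     \<lparr>fobj = (\<lambda>A. osub1 \<Gamma> B A),
      fmor = (\<lambda>A A' g. msub C (ext C (ext C \<Gamma> B) (osub1 \<Gamma> B A)) (ext C \<Gamma> A)
        (lift (ext C \<Gamma> B) \<Gamma> A (pr1 C \<Gamma> B)) (osub1 \<Gamma> A A') g)\<rparr>"

definition Sigma_functor :: "'o \<Rightarrow> 'd \<Rightarrow> ('d, 'e, 'd, 'e) functor_data" where
  "Sigma_functor \<Gamma> B =
     \<lparr>fobj = (\<lambda>X. SigmaD C \<Gamma> B X),
      fmor = (\<lambda>X X' h. let E = ext C \<Gamma> (SigmaD C \<Gamma> B X) in
        dpair E \<Gamma> B X' (pr1 C \<Gamma> (SigmaD C \<Gamma> B X)) (spr1 C \<Gamma> B X)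
          (msub C E (ext C (ext C \<Gamma> B) X) (pair_iso_inv \<Gamma> B X) (osub1 (ext C \<Gamma> B) X X') h))\<rparr>"

definition Pi_functor :: "'o \<Rightarrow> 'd \<Rightarrow> ('d, 'e, 'd, 'e) functor_data" where
  "Pi_functor \<Gamma> B =
     \<lparr>fobj = (\<lambda>X. PiD C \<Gamma> B X),
      fmor = (\<lambda>X X' f. let
          P = PiD C \<Gamma> B X;
          E = ext C (ext C \<Gamma> P) (osub1 \<Gamma> P B)
        in wk_curry \<Gamma> P B X' (PiD C \<Gamma> B X') (dev C \<Gamma> B X')
          (msub C E (ext C (ext C \<Gamma> B) X)
            (pair E (ext C \<Gamma> B) X (lift (ext C \<Gamma> P) \<Gamma> B (pr1 C \<Gamma> P)) (dev C \<Gamma> B X))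
            (osub1 (ext C \<Gamma> B) X X') f))\<rparr>"

end

end

(*
  A morphism A -> B of the category of D-objects over Gamma is the same thing as a morphism
  Gamma.A -> Gamma.B over Gamma, and transposition along both adjunctions is substitution along an
  isomorphism of contexts: Gamma.B.C = Gamma.Sigma(B,C) for the first one, and the exchange
  Gamma.A.B{pi_1} = Gamma.B.A{pi_1}, followed by currying, for the second one.  Once these bijections
  are known to be natural, the functoriality of Sigma(B,_) and Pi(B,_) is automatic.
*)

theory Submission
  imports Defs
begin

section \<open>Adjunctions\<close>

text \<open>A{\<phi>}{\<psi>} = A{\<phi> o \<psi>} is a proved equality of D-objects, and every
  substitution carries its source, target and type. So an equation between D-morphisms usually comes
  with one between types, and much of the bookkeeping is of that kind. Replacing f by the context
  morphism <pi_1,f> reduces it: composition becomes composition in \<open>C\<close>, and morphisms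
  into an extended context are compared by components. The universal properties enter in the same
  form. Uniqueness of [g,h] becomes monicity of a map \<Gamma>.\<Sigma>(A,B) -> \<Gamma>.A.B. A
  \<Pi>-space postulates that currying commutes with substitution along the morphisms <pi_1,g>
  between extensions of one \<Gamma>, which are exactly those that come from C_\<Gamma>. Naturality
  of the second adjunction in its first variable is this law; in its second variable it is the same
  law along the transpose itself.\<close>

lemma is_functorD:
  assumes "is_functor C D F"
  shows "category C" "category D"
    "X \<in> obj C \<Longrightarrow> fobj F X \<in> obj D"
    "\<lbrakk>X \<in> obj C; Y \<in> obj C; f \<in> hom C X Y\<rbrakk> \<Longrightarrow> fmor F X Y f \<in> hom D (fobj F X) (fobj F Y)"
    "X \<in> obj C \<Longrightarrow> fmor F X X (ide C X) = ide D (fobj F X)"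
    "\<lbrakk>X \<in> obj C; Y \<in> obj C; Z \<in> obj C; f \<in> hom C X Y; g \<in> hom C Y Z\<rbrakk> \<Longrightarrow>
      fmor F X Z (cmp C X Y Z g f) =
      cmp D (fobj F X) (fobj F Y) (fobj F Z) (fmor F Y Z g) (fmor F X Y f)"
  using assms unfolding is_functor_def by auto

lemma is_functor_comp:
  assumes F: "is_functor C D F" and G: "is_functor D E G"
  shows "is_functor C E (functor_comp G F)"
  unfolding is_functor_def
  by (auto simp: functor_comp_def is_functorD[OF F] is_functorD[OF G])

text \<open>
  A right adjoint is determined on morphisms by \<open>G v = \<Phi> (v \<circ> \<epsilon>)\<close>, where \<open>\<Phi> \<epsilon> = id\<close>, so its
  functoriality is a consequence of naturality.
\<close>

lemma adjoint_rightI: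
  assumes F: "is_functor C D F"
    and G_obj: "\<And>Y. Y \<in> obj D \<Longrightarrow> fobj G Y \<in> obj C"
    and G_mor: "\<And>Y Y' v. \<lbrakk>Y \<in> obj D; Y' \<in> obj D; v \<in> hom D Y Y'\<rbrakk> \<Longrightarrow>
      fmor G Y Y' v \<in> hom C (fobj G Y) (fobj G Y')"
    and bij: "\<And>X Y. \<lbrakk>X \<in> obj C; Y \<in> obj D\<rbrakk> \<Longrightarrow>
      bij_betw (\<Phi> X Y) (hom D (fobj F X) Y) (hom C X (fobj G Y))"
    and natural: "\<And>X X' Y Y' u v k. \<lbrakk>X \<in> obj C; X' \<in> obj C; Y \<in> obj D; Y' \<in> obj D;
        u \<in> hom C X' X; v \<in> hom D Y Y'; k \<in> hom D (fobj F X) Y\<rbrakk> \<Longrightarrow>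
      \<Phi> X' Y' (cmp D (fobj F X') Y Y' v (cmp D (fobj F X') (fobj F X) Y k (fmor F X' X u))) =
      cmp C X' (fobj G Y) (fobj G Y') (fmor G Y Y' v) (cmp C X' X (fobj G Y) (\<Phi> X Y k) u)"
  shows "adjoint C D F G"
proof -
  interpret C: category C using F by (rule is_functorD)
  interpret D: category D using F by (rule is_functorD)
  note FD = is_functorD(3-)[OF F]
  have counit: "\<exists>\<epsilon> \<in> hom D (fobj F (fobj G Y)) Y. \<Phi> (fobj G Y) Y \<epsilon> = ide C (fobj G Y)"
    if "Y \<in> obj D" for Y
    using bij[OF G_obj that] that C.ide_in_hom[OF G_obj[OF that]]
    unfolding bij_betw_def by (metis imageE)
  have G_v: "fmor G Y Y' v = \<Phi> (fobj G Y) Y' (cmp D (fobj F (fobj G Y)) Y Y' v \<epsilon>)"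
    if *: "Y \<in> obj D" "Y' \<in> obj D" "v \<in> hom D Y Y'"
      "\<epsilon> \<in> hom D (fobj F (fobj G Y)) Y" "\<Phi> (fobj G Y) Y \<epsilon> = ide C (fobj G Y)" for Y Y' v \<epsilon>
    using natural[OF G_obj G_obj *(1,2) C.ide_in_hom *(3,4)] *
    by (simp add: FD G_obj G_mor C.ide_in_hom C.cmp_ide_right D.cmp_ide_right)
  have "is_functor D C G"
    unfolding is_functor_def
  proof (intro conjI ballI)
    show "fmor G Y Y (ide D Y) = ide C (fobj G Y)" if "Y \<in> obj D" for Y
      using counit[OF that] that by (force simp: G_v D.ide_in_hom D.cmp_ide_left FD G_obj)
  next
    fix X Y Z f g
    assume X: "X \<in> obj D" and Y: "Y \<in> obj D" and Z: "Z \<in> obj D"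
      and f: "f \<in> hom D X Y" and g: "g \<in> hom D Y Z"
    obtain \<epsilon> where \<epsilon>: "\<epsilon> \<in> hom D (fobj F (fobj G X)) X" "\<Phi> (fobj G X) X \<epsilon> = ide C (fobj G X)"
      using counit[OF X] by blast
    let ?k = "cmp D (fobj F (fobj G X)) X Y f \<epsilon>"
    have k: "?k \<in> hom D (fobj F (fobj G X)) Y"
      using X Y f \<epsilon> by (simp add: D.cmp_in_hom FD G_obj)
    \<comment> \<open>Naturality at u = id and k = f o \<epsilon>. By \<open>G_v\<close> the
      transpose of f o \<epsilon> is G f, so the right-hand side is G g o G f; the left-hand side is
      G (g o f) up to associativity, again by \<open>G_v\<close>.\<close>
    have "\<Phi> (fobj G X) Z (cmp D (fobj F (fobj G X)) Y Z g ?k) =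
      cmp C (fobj G X) (fobj G Y) (fobj G Z) (fmor G Y Z g) (\<Phi> (fobj G X) Y ?k)"
      using natural[OF G_obj G_obj Y Z C.ide_in_hom g k] X Y Z f g k \<epsilon> G_v[OF X Y f \<epsilon>]
        G_mor[OF X Y f]
      by (simp add: FD G_obj C.ide_in_hom C.cmp_ide_right D.cmp_ide_right)
    then show "fmor G X Z (cmp D X Y Z g f) =
        cmp C (fobj G X) (fobj G Y) (fobj G Z) (fmor G Y Z g) (fmor G X Y f)"
      using X Y Z f g \<epsilon> by (simp add: G_v D.cmp_in_hom D.cmp_assoc FD G_obj)
  qed (use C.category_axioms D.category_axioms G_obj G_mor in auto)
  then show ?thesis
    unfolding adjoint_def using F bij natural by blast
qed

text \<open>Dually, a left adjoint is determined on morphisms by \<open>\<Phi> (F u) = \<eta> \<circ> u\<close>, where \<open>\<eta> = \<Phi> id\<close>.\<close>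

lemma adjoint_leftI:
  assumes G: "is_functor D C G"
    and F_obj: "\<And>X. X \<in> obj C \<Longrightarrow> fobj F X \<in> obj D"
    and F_mor: "\<And>X X' u. \<lbrakk>X \<in> obj C; X' \<in> obj C; u \<in> hom C X X'\<rbrakk> \<Longrightarrow>
      fmor F X X' u \<in> hom D (fobj F X) (fobj F X')"
    and bij: "\<And>X Y. \<lbrakk>X \<in> obj C; Y \<in> obj D\<rbrakk> \<Longrightarrow>
      bij_betw (\<Phi> X Y) (hom D (fobj F X) Y) (hom C X (fobj G Y))"
    and natural: "\<And>X X' Y Y' u v k. \<lbrakk>X \<in> obj C; X' \<in> obj C; Y \<in> obj D; Y' \<in> obj D;
        u \<in> hom C X' X; v \<in> hom D Y Y'; k \<in> hom D (fobj F X) Y\<rbrakk> \<Longrightarrow>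
      \<Phi> X' Y' (cmp D (fobj F X') Y Y' v (cmp D (fobj F X') (fobj F X) Y k (fmor F X' X u))) =
      cmp C X' (fobj G Y) (fobj G Y') (fmor G Y Y' v) (cmp C X' X (fobj G Y) (\<Phi> X Y k) u)"
  shows "adjoint C D F G"
proof -
  interpret C: category C using G by (rule is_functorD)
  interpret D: category D using G by (rule is_functorD)
  note GD = is_functorD(3-)[OF G]
  have \<Phi>_in: "\<Phi> X Y k \<in> hom C X (fobj G Y)"
    if "X \<in> obj C" "Y \<in> obj D" "k \<in> hom D (fobj F X) Y" for X Y k
    using bij[OF that(1,2)] that(3) by (auto simp: bij_betw_def)
  have inj: "k = k'"
    if "\<Phi> X Y k = \<Phi> X Y k'" "X \<in> obj C" "Y \<in> obj D"
      "k \<in> hom D (fobj F X) Y" "k' \<in> hom D (fobj F X) Y" for X Y k k'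
    using bij[OF that(2,3)] that by (auto simp: bij_betw_def dest: inj_onD)
  \<comment> \<open>The case v = id of naturality; G, unlike F, is already known to preserve
    identities.\<close>
  have pre: "\<Phi> X' Y (cmp D (fobj F X') (fobj F X) Y k (fmor F X' X u)) =
      cmp C X' X (fobj G Y) (\<Phi> X Y k) u"
    if *: "X \<in> obj C" "X' \<in> obj C" "Y \<in> obj D" "u \<in> hom C X' X" "k \<in> hom D (fobj F X) Y"
    for X X' Y u k
  proof -
    have "cmp D (fobj F X') (fobj F X) Y k (fmor F X' X u) \<in> hom D (fobj F X') Y"
      using * by (simp add: D.cmp_in_hom F_obj F_mor)
    moreover have "cmp C X' X (fobj G Y) (\<Phi> X Y k) u \<in> hom C X' (fobj G Y)"
      using * by (simp add: C.cmp_in_hom GD \<Phi>_in)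
    ultimately show ?thesis
      using natural[OF *(1,2,3,3,4) D.ide_in_hom *(5)] *
      by (simp add: GD F_obj C.cmp_ide_left D.cmp_ide_left)
  qed
  \<comment> \<open>Both functor laws equate morphisms out of F X, so they may be tested after the
    injective \<Phi>, where \<open>pre\<close> trades each F u for a precomposition with u.\<close>
  have "is_functor C D F"
    unfolding is_functor_def
  proof (intro conjI ballI)
    fix X assume X: "X \<in> obj C"
    show "fmor F X X (ide C X) = ide D (fobj F X)"
      using pre[OF X X F_obj[OF X] C.ide_in_hom[OF X] D.ide_in_hom[OF F_obj[OF X]]] X
      by (intro inj[of X "fobj F X"])
        (simp_all add: F_obj F_mor \<Phi>_in C.ide_in_hom D.ide_in_hom C.cmp_ide_right D.cmp_ide_left GD)
  next
    fix X Y Z f g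
    assume *: "X \<in> obj C" "Y \<in> obj C" "Z \<in> obj C" "f \<in> hom C X Y" "g \<in> hom C Y Z"
    note ty = * F_obj F_mor C.cmp_in_hom D.cmp_in_hom D.ide_in_hom GD \<Phi>_in
    have "\<Phi> X (fobj F Z) (fmor F X Z (cmp C X Y Z g f)) =
      cmp C X Z (fobj G (fobj F Z)) (\<Phi> Z (fobj F Z) (ide D (fobj F Z))) (cmp C X Y Z g f)"
      using pre[of Z X "fobj F Z" "cmp C X Y Z g f" "ide D (fobj F Z)"]
      by (simp add: ty D.cmp_ide_left)
    also have "\<dots> = cmp C X Y (fobj G (fobj F Z)) (\<Phi> Y (fobj F Z) (fmor F Y Z g)) f"
      using pre[of Z Y "fobj F Z" g "ide D (fobj F Z)"]
        C.cmp_assoc[of X Y Z "fobj G (fobj F Z)" f g "\<Phi> Z (fobj F Z) (ide D (fobj F Z))"]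
      by (simp add: ty D.cmp_ide_left)
    also have "\<dots> = \<Phi> X (fobj F Z)
        (cmp D (fobj F X) (fobj F Y) (fobj F Z) (fmor F Y Z g) (fmor F X Y f))"
      using pre[of Y X "fobj F Z" f "fmor F Y Z g"] by (simp add: ty)
    finally show "fmor F X Z (cmp C X Y Z g f) =
        cmp D (fobj F X) (fobj F Y) (fobj F Z) (fmor F Y Z g) (fmor F X Y f)"
      by (rule inj) (simp_all add: ty)
  qed (use C.category_axioms D.category_axioms F_obj F_mor in auto)
  then show ?thesis
    unfolding adjoint_def using G bij natural by blast
qed

text \<open>Transposition takes two steps, \<Psi> at (F X, Y) and then \<Phi> at (X, K Y).
  Naturality of \<Psi> along F u and v leaves a morphism of exactly the shape to which naturality of
  \<Phi> along u and K v applies.\<close>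

lemma adjoint_comp:
  assumes FG: "adjoint C D F G" and HK: "adjoint D E H K"
  shows "adjoint C E (functor_comp H F) (functor_comp G K)"
proof -
  have F: "is_functor C D F" and G: "is_functor D C G"
    and H: "is_functor D E H" and K: "is_functor E D K"
    using FG HK by (simp_all add: adjoint_def)
  note ty = is_functorD(3,4)[OF F] is_functorD(3,4)[OF H] is_functorD(3,4)[OF K]
  obtain \<Phi> where \<Phi>: "\<And>X Y. \<lbrakk>X \<in> obj C; Y \<in> obj D\<rbrakk> \<Longrightarrow>
      bij_betw (\<Phi> X Y) (hom D (fobj F X) Y) (hom C X (fobj G Y))"
    "\<And>X X' Y Y' u v k. \<lbrakk>X \<in> obj C; X' \<in> obj C; Y \<in> obj D; Y' \<in> obj D;
        u \<in> hom C X' X; v \<in> hom D Y Y'; k \<in> hom D (fobj F X) Y\<rbrakk> \<Longrightarrow>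
      \<Phi> X' Y' (cmp D (fobj F X') Y Y' v (cmp D (fobj F X') (fobj F X) Y k (fmor F X' X u))) =
      cmp C X' (fobj G Y) (fobj G Y') (fmor G Y Y' v) (cmp C X' X (fobj G Y) (\<Phi> X Y k) u)"
    using FG unfolding adjoint_def by blast
  obtain \<Psi> where \<Psi>: "\<And>X Y. \<lbrakk>X \<in> obj D; Y \<in> obj E\<rbrakk> \<Longrightarrow>
      bij_betw (\<Psi> X Y) (hom E (fobj H X) Y) (hom D X (fobj K Y))"
    "\<And>X X' Y Y' u v k. \<lbrakk>X \<in> obj D; X' \<in> obj D; Y \<in> obj E; Y' \<in> obj E;
        u \<in> hom D X' X; v \<in> hom E Y Y'; k \<in> hom E (fobj H X) Y\<rbrakk> \<Longrightarrow>
      \<Psi> X' Y' (cmp E (fobj H X') Y Y' v (cmp E (fobj H X') (fobj H X) Y k (fmor H X' X u))) =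
      cmp D X' (fobj K Y) (fobj K Y') (fmor K Y Y' v) (cmp D X' X (fobj K Y) (\<Psi> X Y k) u)"
    using HK unfolding adjoint_def by blast
  have \<Psi>_in: "\<Psi> X Y k \<in> hom D X (fobj K Y)"
    if "X \<in> obj D" "Y \<in> obj E" "k \<in> hom E (fobj H X) Y" for X Y k
    using \<Psi>(1)[OF that(1,2)] that(3) by (auto simp: bij_betw_def)
  show ?thesis
  proof (rule adjoint_rightI[where \<Phi> = "\<lambda>X Y k. \<Phi> X (fobj K Y) (\<Psi> (fobj F X) Y k)"])
    show "is_functor C E (functor_comp H F)"
      by (rule is_functor_comp[OF F H])
  next
    fix X Y assume "X \<in> obj C" "Y \<in> obj E"
    then show "bij_betw (\<lambda>k. \<Phi> X (fobj K Y) (\<Psi> (fobj F X) Y k))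
        (hom E (fobj (functor_comp H F) X) Y) (hom C X (fobj (functor_comp G K) Y))"
      using bij_betw_trans[OF \<Psi>(1)[of "fobj F X" Y] \<Phi>(1)[of X "fobj K Y"]]
      by (simp add: functor_comp_def ty comp_def)
  qed (simp_all add: functor_comp_def ty is_functorD(3,4)[OF G] \<Phi>(2) \<Psi>(2) \<Psi>_in)
qed


section \<open>Contexts and slices\<close>

context sccwd
begin

lemmas [simp] = ide_in_hom cmp_in_hom cmp_ide_left cmp_ide_right
  osub_in msub_in osub_ide msub_ide

lemma ext_in [simp]: "\<lbrakk>\<Gamma> \<in> obj C; A \<in> dobj C \<Gamma>\<rbrakk> \<Longrightarrow> ext C \<Gamma> A \<in> obj C"
  and pr1_in [simp]: "\<lbrakk>\<Gamma> \<in> obj C; A \<in> dobj C \<Gamma>\<rbrakk> \<Longrightarrow> pr1 C \<Gamma> A \<in> hom C (ext C \<Gamma> A) \<Gamma>"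
  and pr2_in [simp]: "\<lbrakk>\<Gamma> \<in> obj C; A \<in> dobj C \<Gamma>\<rbrakk> \<Longrightarrow> pr2 C \<Gamma> A \<in> dmor C (ext C \<Gamma> A) (osub1 \<Gamma> A A)"
  using semi_sigma[of \<Gamma> A] by (simp_all add: is_semi_sigma_def osub1_def)

lemma osub1_in [simp]:
  "\<lbrakk>\<Gamma> \<in> obj C; A \<in> dobj C \<Gamma>; X \<in> dobj C \<Gamma>\<rbrakk> \<Longrightarrow> osub1 \<Gamma> X A \<in> dobj C (ext C \<Gamma> X)"
  by (simp add: osub1_def)

text \<open>
  The type of a substituted D-morphism is rarely syntactically equal to the expected one, so the
  typing and composition rules for substitution leave the equation between types as a premise.
\<close>

lemma msub_in':
  "\<lbrakk>\<Delta> \<in> obj C; \<Gamma> \<in> obj C; \<phi> \<in> hom C \<Delta> \<Gamma>; A \<in> dobj C \<Gamma>; a \<in> dmor C \<Gamma> A;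
    A' = osub C \<Delta> \<Gamma> \<phi> A\<rbrakk> \<Longrightarrow> msub C \<Delta> \<Gamma> \<phi> A a \<in> dmor C \<Delta> A'"
  by simp

lemma msub_msub:
  "\<lbrakk>A' = osub C \<Delta> \<Gamma> \<phi> A; \<Theta> \<in> obj C; \<Delta> \<in> obj C; \<Gamma> \<in> obj C;
    \<psi> \<in> hom C \<Theta> \<Delta>; \<phi> \<in> hom C \<Delta> \<Gamma>; A \<in> dobj C \<Gamma>; a \<in> dmor C \<Gamma> A\<rbrakk> \<Longrightarrow>
   msub C \<Theta> \<Delta> \<psi> A' (msub C \<Delta> \<Gamma> \<phi> A a) = msub C \<Theta> \<Gamma> (cmp C \<Theta> \<Delta> \<Gamma> \<phi> \<psi>) A a"
  by (simp add: msub_cmp)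

text \<open>Oriented so that iterated substitutions merge: two types A{\<phi>} and A{\<psi>} are
  then identified by proving \<phi> = \<psi>.\<close>

lemma osub_osub [simp]:
  "\<lbrakk>\<Theta> \<in> obj C; \<Delta> \<in> obj C; \<Gamma> \<in> obj C; \<psi> \<in> hom C \<Theta> \<Delta>; \<phi> \<in> hom C \<Delta> \<Gamma>; A \<in> dobj C \<Gamma>\<rbrakk> \<Longrightarrow>
   osub C \<Theta> \<Delta> \<psi> (osub C \<Delta> \<Gamma> \<phi> A) = osub C \<Theta> \<Gamma> (cmp C \<Theta> \<Delta> \<Gamma> \<phi> \<psi>) A"
  by (simp add: osub_cmp)

text \<open>\<open>osub1\<close> stays folded because the hom-sets of \<open>slice\<close> are
  written with it, so merging needs a rule of its own.\<close>

lemma osub_osub1 [simp]: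
  "\<lbrakk>\<Theta> \<in> obj C; \<Gamma> \<in> obj C; X \<in> dobj C \<Gamma>; \<psi> \<in> hom C \<Theta> (ext C \<Gamma> X); A \<in> dobj C \<Gamma>\<rbrakk> \<Longrightarrow>
   osub C \<Theta> (ext C \<Gamma> X) \<psi> (osub1 \<Gamma> X A) =
     osub C \<Theta> \<Gamma> (cmp C \<Theta> (ext C \<Gamma> X) \<Gamma> (pr1 C \<Gamma> X) \<psi>) A"
  by (simp add: osub1_def)

section \<open>Morphisms into an extended context\<close>

lemma pair_ex1:
  assumes "\<Delta> \<in> obj C" "\<Gamma> \<in> obj C" "A \<in> dobj C \<Gamma>" "\<phi> \<in> hom C \<Delta> \<Gamma>"
    "g \<in> dmor C \<Delta> (osub C \<Delta> \<Gamma> \<phi> A)"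
  shows "\<exists>!u. u \<in> hom C \<Delta> (ext C \<Gamma> A) \<and> cmp C \<Delta> (ext C \<Gamma> A) \<Gamma> (pr1 C \<Gamma> A) u = \<phi> \<and>
      msub C \<Delta> (ext C \<Gamma> A) u (osub1 \<Gamma> A A) (pr2 C \<Gamma> A) = g"
  using semi_sigma[OF assms(2,3)] assms unfolding is_semi_sigma_def osub1_def by blast

lemma
  assumes "\<Delta> \<in> obj C" "\<Gamma> \<in> obj C" "A \<in> dobj C \<Gamma>" "\<phi> \<in> hom C \<Delta> \<Gamma>"
    "g \<in> dmor C \<Delta> (osub C \<Delta> \<Gamma> \<phi> A)"
  shows pair_in: "pair \<Delta> \<Gamma> A \<phi> g \<in> hom C \<Delta> (ext C \<Gamma> A)"
    and pr1_pair: "cmp C \<Delta> (ext C \<Gamma> A) \<Gamma> (pr1 C \<Gamma> A) (pair \<Delta> \<Gamma> A \<phi> g) = \<phi>"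
    and pr2_pair: "msub C \<Delta> (ext C \<Gamma> A) (pair \<Delta> \<Gamma> A \<phi> g) (osub1 \<Gamma> A A) (pr2 C \<Gamma> A) = g"
proof -
  from theI'[OF pair_ex1[OF assms]] show
    "pair \<Delta> \<Gamma> A \<phi> g \<in> hom C \<Delta> (ext C \<Gamma> A)"
    "cmp C \<Delta> (ext C \<Gamma> A) \<Gamma> (pr1 C \<Gamma> A) (pair \<Delta> \<Gamma> A \<phi> g) = \<phi>"
    "msub C \<Delta> (ext C \<Gamma> A) (pair \<Delta> \<Gamma> A \<phi> g) (osub1 \<Gamma> A A) (pr2 C \<Gamma> A) = g"
    by (simp_all add: pair_def)
qed

lemmas [simp] = pair_in pr1_pair pr2_pair

lemma pair_unique:
  assumes "\<Delta> \<in> obj C" "\<Gamma> \<in> obj C" "A \<in> dobj C \<Gamma>" "\<phi> \<in> hom C \<Delta> \<Gamma>"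
    "g \<in> dmor C \<Delta> (osub C \<Delta> \<Gamma> \<phi> A)" "u \<in> hom C \<Delta> (ext C \<Gamma> A)"
    "cmp C \<Delta> (ext C \<Gamma> A) \<Gamma> (pr1 C \<Gamma> A) u = \<phi>"
    "msub C \<Delta> (ext C \<Gamma> A) u (osub1 \<Gamma> A A) (pr2 C \<Gamma> A) = g"
  shows "pair \<Delta> \<Gamma> A \<phi> g = u"
  unfolding pair_def by (rule the1_equality[OF pair_ex1[OF assms(1-5)]]) (use assms(6-8) in simp)

lemma pr2_sub_in [simp]:
  "\<lbrakk>\<Delta> \<in> obj C; \<Gamma> \<in> obj C; A \<in> dobj C \<Gamma>; u \<in> hom C \<Delta> (ext C \<Gamma> A)\<rbrakk> \<Longrightarrow>
   msub C \<Delta> (ext C \<Gamma> A) u (osub1 \<Gamma> A A) (pr2 C \<Gamma> A) \<in>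
     dmor C \<Delta> (osub C \<Delta> \<Gamma> (cmp C \<Delta> (ext C \<Gamma> A) \<Gamma> (pr1 C \<Gamma> A) u) A)"
  by (intro msub_in') simp_all

lemma pair_eta:
  "\<lbrakk>\<Delta> \<in> obj C; \<Gamma> \<in> obj C; A \<in> dobj C \<Gamma>; u \<in> hom C \<Delta> (ext C \<Gamma> A)\<rbrakk> \<Longrightarrow>
   pair \<Delta> \<Gamma> A (cmp C \<Delta> (ext C \<Gamma> A) \<Gamma> (pr1 C \<Gamma> A) u)
     (msub C \<Delta> (ext C \<Gamma> A) u (osub1 \<Gamma> A A) (pr2 C \<Gamma> A)) = u"
  by (intro pair_unique) simp_all

text \<open>A morphism into \<Gamma>.A is rebuilt from its components by \<open>pair_eta\<close>, so
  pi_1 and pi_2 are jointly monic. This is the usual way below of identifying morphisms of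
  contexts.\<close>

lemma ext_eqI:
  assumes "\<Delta> \<in> obj C" "\<Gamma> \<in> obj C" "A \<in> dobj C \<Gamma>"
    and "u \<in> hom C \<Delta> (ext C \<Gamma> A)" "v \<in> hom C \<Delta> (ext C \<Gamma> A)"
    and "cmp C \<Delta> (ext C \<Gamma> A) \<Gamma> (pr1 C \<Gamma> A) u = cmp C \<Delta> (ext C \<Gamma> A) \<Gamma> (pr1 C \<Gamma> A) v"
    and "msub C \<Delta> (ext C \<Gamma> A) u (osub1 \<Gamma> A A) (pr2 C \<Gamma> A) =
      msub C \<Delta> (ext C \<Gamma> A) v (osub1 \<Gamma> A A) (pr2 C \<Gamma> A)"
  shows "u = v"
  using pair_eta[OF assms(1-3,4)] pair_eta[OF assms(1-3,5)] unfolding assms(6,7) by (rule trans[OF sym])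

lemma pr1_pair_cmp [simp]:
  assumes "\<Theta> \<in> obj C" "\<Delta> \<in> obj C" "\<Gamma> \<in> obj C" "A \<in> dobj C \<Gamma>"
    "\<phi> \<in> hom C \<Delta> \<Gamma>" "g \<in> dmor C \<Delta> (osub C \<Delta> \<Gamma> \<phi> A)" "\<psi> \<in> hom C \<Theta> \<Delta>"
  shows "cmp C \<Theta> (ext C \<Gamma> A) \<Gamma> (pr1 C \<Gamma> A) (cmp C \<Theta> \<Delta> (ext C \<Gamma> A) (pair \<Delta> \<Gamma> A \<phi> g) \<psi>) =
    cmp C \<Theta> \<Delta> \<Gamma> \<phi> \<psi>"
  using assms by (simp flip: cmp_assoc)

lemma pair_cmp:
  assumes "\<Theta> \<in> obj C" "\<Delta> \<in> obj C" "\<Gamma> \<in> obj C" "A \<in> dobj C \<Gamma>"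
    "\<phi> \<in> hom C \<Delta> \<Gamma>" "g \<in> dmor C \<Delta> (osub C \<Delta> \<Gamma> \<phi> A)" "\<psi> \<in> hom C \<Theta> \<Delta>"
  shows "cmp C \<Theta> \<Delta> (ext C \<Gamma> A) (pair \<Delta> \<Gamma> A \<phi> g) \<psi> =
    pair \<Theta> \<Gamma> A (cmp C \<Theta> \<Delta> \<Gamma> \<phi> \<psi>) (msub C \<Theta> \<Delta> \<psi> (osub C \<Delta> \<Gamma> \<phi> A) g)"
proof (rule ext_eqI[of \<Theta> \<Gamma> A])
  have g: "msub C \<Theta> \<Delta> \<psi> (osub C \<Delta> \<Gamma> \<phi> A) g \<in> dmor C \<Theta> (osub C \<Theta> \<Gamma> (cmp C \<Theta> \<Delta> \<Gamma> \<phi> \<psi>) A)"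
    using assms by (intro msub_in') auto
  show "pair \<Theta> \<Gamma> A (cmp C \<Theta> \<Delta> \<Gamma> \<phi> \<psi>) (msub C \<Theta> \<Delta> \<psi> (osub C \<Delta> \<Gamma> \<phi> A) g) \<in> hom C \<Theta> (ext C \<Gamma> A)"
    using g assms by simp
  show "cmp C \<Theta> (ext C \<Gamma> A) \<Gamma> (pr1 C \<Gamma> A) (cmp C \<Theta> \<Delta> (ext C \<Gamma> A) (pair \<Delta> \<Gamma> A \<phi> g) \<psi>) =
      cmp C \<Theta> (ext C \<Gamma> A) \<Gamma> (pr1 C \<Gamma> A)
        (pair \<Theta> \<Gamma> A (cmp C \<Theta> \<Delta> \<Gamma> \<phi> \<psi>) (msub C \<Theta> \<Delta> \<psi> (osub C \<Delta> \<Gamma> \<phi> A) g))"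
    using g assms by simp
  have "msub C \<Theta> (ext C \<Gamma> A) (cmp C \<Theta> \<Delta> (ext C \<Gamma> A) (pair \<Delta> \<Gamma> A \<phi> g) \<psi>) (osub1 \<Gamma> A A) (pr2 C \<Gamma> A) =
      msub C \<Theta> \<Delta> \<psi> (osub C \<Delta> \<Gamma> \<phi> A) g"
    using assms by (subst msub_cmp) simp_all
  then show "msub C \<Theta> (ext C \<Gamma> A) (cmp C \<Theta> \<Delta> (ext C \<Gamma> A) (pair \<Delta> \<Gamma> A \<phi> g) \<psi>) (osub1 \<Gamma> A A)
      (pr2 C \<Gamma> A) =
    msub C \<Theta> (ext C \<Gamma> A) (pair \<Theta> \<Gamma> A (cmp C \<Theta> \<Delta> \<Gamma> \<phi> \<psi>) (msub C \<Theta> \<Delta> \<psi> (osub C \<Delta> \<Gamma> \<phi> A) g))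
      (osub1 \<Gamma> A A) (pr2 C \<Gamma> A)"
    using g assms by simp
qed (use assms in simp_all)

text \<open>The premise on \<open>A'\<close> lets these rules apply when \<open>A{\<phi>}\<close> is written as an \<open>osub1\<close>.\<close>

lemma
  assumes "\<Delta> \<in> obj C" "\<Gamma> \<in> obj C" "A \<in> dobj C \<Gamma>" "\<phi> \<in> hom C \<Delta> \<Gamma>" "A' = osub C \<Delta> \<Gamma> \<phi> A"
  shows lift_in: "lift \<Delta> \<Gamma> A \<phi> \<in> hom C (ext C \<Delta> A') (ext C \<Gamma> A)"
    and pr1_lift: "cmp C (ext C \<Delta> A') (ext C \<Gamma> A) \<Gamma> (pr1 C \<Gamma> A) (lift \<Delta> \<Gamma> A \<phi>) =
      cmp C (ext C \<Delta> A') \<Delta> \<Gamma> \<phi> (pr1 C \<Delta> A')"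
    and pr2_lift: "msub C (ext C \<Delta> A') (ext C \<Gamma> A) (lift \<Delta> \<Gamma> A \<phi>) (osub1 \<Gamma> A A) (pr2 C \<Gamma> A) =
      pr2 C \<Delta> A'"
proof -
  have A': "A' \<in> dobj C \<Delta>" using assms by simp
  then have "pr2 C \<Delta> A' \<in> dmor C (ext C \<Delta> A')
      (osub C (ext C \<Delta> A') \<Gamma> (cmp C (ext C \<Delta> A') \<Delta> \<Gamma> \<phi> (pr1 C \<Delta> A')) A)"
    using pr2_in[of \<Delta> A'] assms unfolding osub1_def by simp
  then show "lift \<Delta> \<Gamma> A \<phi> \<in> hom C (ext C \<Delta> A') (ext C \<Gamma> A)"
    "cmp C (ext C \<Delta> A') (ext C \<Gamma> A) \<Gamma> (pr1 C \<Gamma> A) (lift \<Delta> \<Gamma> A \<phi>) =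
      cmp C (ext C \<Delta> A') \<Delta> \<Gamma> \<phi> (pr1 C \<Delta> A')"
    "msub C (ext C \<Delta> A') (ext C \<Gamma> A) (lift \<Delta> \<Gamma> A \<phi>) (osub1 \<Gamma> A A) (pr2 C \<Gamma> A) = pr2 C \<Delta> A'"
    using assms A' by (simp_all add: lift_def Let_def)
qed

lemma
  assumes "\<Theta> \<in> obj C" "\<Delta> \<in> obj C" "\<Gamma> \<in> obj C" "A \<in> dobj C \<Gamma>" "\<phi> \<in> hom C \<Delta> \<Gamma>"
    "A' = osub C \<Delta> \<Gamma> \<phi> A" "\<psi> \<in> hom C \<Theta> (ext C \<Delta> A')"
  shows pr1_lift_cmp: "cmp C \<Theta> (ext C \<Gamma> A) \<Gamma> (pr1 C \<Gamma> A)
      (cmp C \<Theta> (ext C \<Delta> A') (ext C \<Gamma> A) (lift \<Delta> \<Gamma> A \<phi>) \<psi>) =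
      cmp C \<Theta> \<Delta> \<Gamma> \<phi> (cmp C \<Theta> (ext C \<Delta> A') \<Delta> (pr1 C \<Delta> A') \<psi>)"
    and pr2_lift_cmp: "msub C \<Theta> (ext C \<Gamma> A) (cmp C \<Theta> (ext C \<Delta> A') (ext C \<Gamma> A) (lift \<Delta> \<Gamma> A \<phi>) \<psi>)
      (osub1 \<Gamma> A A) (pr2 C \<Gamma> A) = msub C \<Theta> (ext C \<Delta> A') \<psi> (osub1 \<Delta> A' A') (pr2 C \<Delta> A')"
proof -
  have A': "A' \<in> dobj C \<Delta>" using assms by simp
  have l: "lift \<Delta> \<Gamma> A \<phi> \<in> hom C (ext C \<Delta> A') (ext C \<Gamma> A)"
    by (rule lift_in) (use assms in auto)
  show "cmp C \<Theta> (ext C \<Gamma> A) \<Gamma> (pr1 C \<Gamma> A)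
      (cmp C \<Theta> (ext C \<Delta> A') (ext C \<Gamma> A) (lift \<Delta> \<Gamma> A \<phi>) \<psi>) =
      cmp C \<Theta> \<Delta> \<Gamma> \<phi> (cmp C \<Theta> (ext C \<Delta> A') \<Delta> (pr1 C \<Delta> A') \<psi>)"
    using assms(1-5,7) A' l by (simp add: pr1_lift[OF assms(2-6)] flip: cmp_assoc)
  \<comment> \<open>A{pi_1}{\<phi>^+} = A{\<phi>}{pi_1}, since pi_1 o \<phi>^+ = \<phi> o pi_1.
    Splitting the substitution along \<phi>^+ o \<psi> exposes the left-hand type.\<close>
  have "osub C (ext C \<Delta> A') (ext C \<Gamma> A) (lift \<Delta> \<Gamma> A \<phi>) (osub1 \<Gamma> A A) = osub1 \<Delta> A' A'"
    using assms(1-5,7) A' l unfolding osub1_def assms(6)[symmetric]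
    by (simp add: pr1_lift[OF assms(2-6)]) (simp add: assms(6))
  then show "msub C \<Theta> (ext C \<Gamma> A) (cmp C \<Theta> (ext C \<Delta> A') (ext C \<Gamma> A) (lift \<Delta> \<Gamma> A \<phi>) \<psi>)
      (osub1 \<Gamma> A A) (pr2 C \<Gamma> A) = msub C \<Theta> (ext C \<Delta> A') \<psi> (osub1 \<Delta> A' A') (pr2 C \<Delta> A')"
    using assms(1-5,7) A' l by (subst msub_cmp) (simp_all add: pr2_lift[OF assms(2-6)])
qed


subsection \<open>The category of D-objects\<close>

text \<open>
  A morphism \<open>f : A \<rightarrow> B\<close> of \<open>C\<^sub>\<Gamma>\<close> corresponds to the morphism \<open>\<langle>\<pi>\<^sub>1, f\<rangle> : \<Gamma>.A \<rightarrow> \<Gamma>.B\<close> over \<open>\<Gamma>\<close>.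
\<close>

definition total :: "'o \<Rightarrow> 'd \<Rightarrow> 'd \<Rightarrow> 'e \<Rightarrow> 'm" where
  "total \<Gamma> A B f = pair (ext C \<Gamma> A) \<Gamma> B (pr1 C \<Gamma> A) f"

lemma slice_simps [simp]:
  "obj (slice \<Gamma>) = dobj C \<Gamma>"
  "hom (slice \<Gamma>) A B = dmor C (ext C \<Gamma> A) (osub1 \<Gamma> A B)"
  "ide (slice \<Gamma>) A = pr2 C \<Gamma> A"
  "cmp (slice \<Gamma>) X Y Z g f = msub C (ext C \<Gamma> X) (ext C \<Gamma> Y) (total \<Gamma> X Y f) (osub1 \<Gamma> Y Z) g"
  by (simp_all add: slice_def total_def)

lemma
  assumes "\<Gamma> \<in> obj C" "A \<in> dobj C \<Gamma>" "B \<in> dobj C \<Gamma>" "f \<in> dmor C (ext C \<Gamma> A) (osub1 \<Gamma> A B)"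
  shows total_in: "total \<Gamma> A B f \<in> hom C (ext C \<Gamma> A) (ext C \<Gamma> B)"
    and pr1_total: "cmp C (ext C \<Gamma> A) (ext C \<Gamma> B) \<Gamma> (pr1 C \<Gamma> B) (total \<Gamma> A B f) = pr1 C \<Gamma> A"
    and pr2_total:
      "msub C (ext C \<Gamma> A) (ext C \<Gamma> B) (total \<Gamma> A B f) (osub1 \<Gamma> B B) (pr2 C \<Gamma> B) = f"
  using assms by (auto simp: total_def osub1_def[of \<Gamma> A B])

lemmas [simp] = total_in pr1_total pr2_total

lemma pr1_total_cmp [simp]:
  "\<lbrakk>\<Gamma> \<in> obj C; A \<in> dobj C \<Gamma>; B \<in> dobj C \<Gamma>; f \<in> dmor C (ext C \<Gamma> A) (osub1 \<Gamma> A B);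
    \<Theta> \<in> obj C; \<psi> \<in> hom C \<Theta> (ext C \<Gamma> A)\<rbrakk> \<Longrightarrow>
   cmp C \<Theta> (ext C \<Gamma> B) \<Gamma> (pr1 C \<Gamma> B) (cmp C \<Theta> (ext C \<Gamma> A) (ext C \<Gamma> B) (total \<Gamma> A B f) \<psi>) =
     cmp C \<Theta> (ext C \<Gamma> A) \<Gamma> (pr1 C \<Gamma> A) \<psi>"
  by (simp flip: cmp_assoc)

text \<open>Holds because <pi_1,f> lies over \<Gamma>. The result is in \<open>osub1\<close> form,
  whereas \<open>osub_osub1\<close> would unfold the same term; that rule is therefore removed where
  this one is wanted.\<close>

lemma osub_total [simp]:
  "\<lbrakk>\<Gamma> \<in> obj C; X \<in> dobj C \<Gamma>; Y \<in> dobj C \<Gamma>; Z \<in> dobj C \<Gamma>; f \<in> dmor C (ext C \<Gamma> X) (osub1 \<Gamma> X Y)\<rbrakk> \<Longrightarrow>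
   osub C (ext C \<Gamma> X) (ext C \<Gamma> Y) (total \<Gamma> X Y f) (osub1 \<Gamma> Y Z) = osub1 \<Gamma> X Z"
  by simp (simp add: osub1_def)

lemma slice_cmp_in [simp]:
  "\<lbrakk>\<Gamma> \<in> obj C; X \<in> dobj C \<Gamma>; Y \<in> dobj C \<Gamma>; Z \<in> dobj C \<Gamma>;
    f \<in> dmor C (ext C \<Gamma> X) (osub1 \<Gamma> X Y); g \<in> dmor C (ext C \<Gamma> Y) (osub1 \<Gamma> Y Z)\<rbrakk> \<Longrightarrow>
   msub C (ext C \<Gamma> X) (ext C \<Gamma> Y) (total \<Gamma> X Y f) (osub1 \<Gamma> Y Z) g \<in> dmor C (ext C \<Gamma> X) (osub1 \<Gamma> X Z)"
  by (intro msub_in') (simp_all del: osub_osub1)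

lemma pr2_total_cmp:
  "\<lbrakk>\<Gamma> \<in> obj C; A \<in> dobj C \<Gamma>; B \<in> dobj C \<Gamma>; f \<in> dmor C (ext C \<Gamma> A) (osub1 \<Gamma> A B);
    \<Theta> \<in> obj C; \<psi> \<in> hom C \<Theta> (ext C \<Gamma> A)\<rbrakk> \<Longrightarrow>
   msub C \<Theta> (ext C \<Gamma> B) (cmp C \<Theta> (ext C \<Gamma> A) (ext C \<Gamma> B) (total \<Gamma> A B f) \<psi>) (osub1 \<Gamma> B B)
     (pr2 C \<Gamma> B) = msub C \<Theta> (ext C \<Gamma> A) \<psi> (osub1 \<Gamma> A B) f"
  by (subst msub_cmp) (simp_all del: osub_osub1)

lemma total_ide: "\<lbrakk>\<Gamma> \<in> obj C; A \<in> dobj C \<Gamma>\<rbrakk> \<Longrightarrow> total \<Gamma> A A (pr2 C \<Gamma> A) = ide C (ext C \<Gamma> A)"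
  by (rule ext_eqI[of "ext C \<Gamma> A" \<Gamma> A]) simp_all

text \<open>With \<open>total_ide\<close> this represents C_\<Gamma> by context morphisms over
  \<Gamma>. Associativity in C_\<Gamma> then says that substituting along <pi_1,g> and then along
  <pi_1,f> is substituting along their composite.\<close>

lemma total_slice_cmp:
  "\<lbrakk>\<Gamma> \<in> obj C; X \<in> dobj C \<Gamma>; Y \<in> dobj C \<Gamma>; Z \<in> dobj C \<Gamma>;
    f \<in> dmor C (ext C \<Gamma> X) (osub1 \<Gamma> X Y); g \<in> dmor C (ext C \<Gamma> Y) (osub1 \<Gamma> Y Z)\<rbrakk> \<Longrightarrow>
   total \<Gamma> X Z (msub C (ext C \<Gamma> X) (ext C \<Gamma> Y) (total \<Gamma> X Y f) (osub1 \<Gamma> Y Z) g) =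
     cmp C (ext C \<Gamma> X) (ext C \<Gamma> Y) (ext C \<Gamma> Z) (total \<Gamma> Y Z g) (total \<Gamma> X Y f)"
  by (rule ext_eqI[of "ext C \<Gamma> X" \<Gamma> Z]) (simp_all add: pr2_total_cmp)

lemma category_slice: "\<Gamma> \<in> obj C \<Longrightarrow> category (slice \<Gamma>)"
  by unfold_locales
    (simp_all add: total_ide total_slice_cmp msub_msub osub_total del: osub_osub1)

text \<open>Both sides have components \<phi> o \<psi> o pi_1 and pi_2. \<open>A'\<close> and
  \<open>A''\<close> are variables constrained by equations so that they can be instantiated by
  \<open>osub1\<close> terms or, when \<phi> o \<psi> = id, by A itself.\<close>

lemma lift_cmp:
  assumes "\<Theta> \<in> obj C" "\<Delta> \<in> obj C" "\<Gamma> \<in> obj C" "A \<in> dobj C \<Gamma>"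
    "\<phi> \<in> hom C \<Delta> \<Gamma>" "\<psi> \<in> hom C \<Theta> \<Delta>"
    "A' = osub C \<Delta> \<Gamma> \<phi> A" "A'' = osub C \<Theta> \<Delta> \<psi> A'"
  shows "cmp C (ext C \<Theta> A'') (ext C \<Delta> A') (ext C \<Gamma> A) (lift \<Delta> \<Gamma> A \<phi>) (lift \<Theta> \<Delta> A' \<psi>) =
    lift \<Theta> \<Gamma> A (cmp C \<Theta> \<Delta> \<Gamma> \<phi> \<psi>)"
proof -
  have A': "A' \<in> dobj C \<Delta>" and A'': "A'' \<in> dobj C \<Theta>"
    and A''_eq: "A'' = osub C \<Theta> \<Gamma> (cmp C \<Theta> \<Delta> \<Gamma> \<phi> \<psi>) A"
    using assms by simp_all
  have \<phi>: "lift \<Delta> \<Gamma> A \<phi> \<in> hom C (ext C \<Delta> A') (ext C \<Gamma> A)"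
    using assms(2-5,7) by (rule lift_in)
  have \<psi>: "lift \<Theta> \<Delta> A' \<psi> \<in> hom C (ext C \<Theta> A'') (ext C \<Delta> A')"
    using assms(1,2) A' assms(6,8) by (rule lift_in)
  have \<phi>\<psi>: "lift \<Theta> \<Gamma> A (cmp C \<Theta> \<Delta> \<Gamma> \<phi> \<psi>) \<in> hom C (ext C \<Theta> A'') (ext C \<Gamma> A)"
    using assms(1-6) by (intro lift_in A''_eq) simp_all
  show ?thesis
  proof (rule ext_eqI[of "ext C \<Theta> A''" \<Gamma> A])
    show "cmp C (ext C \<Theta> A'') (ext C \<Gamma> A) \<Gamma> (pr1 C \<Gamma> A)
        (cmp C (ext C \<Theta> A'') (ext C \<Delta> A') (ext C \<Gamma> A) (lift \<Delta> \<Gamma> A \<phi>) (lift \<Theta> \<Delta> A' \<psi>)) =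
      cmp C (ext C \<Theta> A'') (ext C \<Gamma> A) \<Gamma> (pr1 C \<Gamma> A) (lift \<Theta> \<Gamma> A (cmp C \<Theta> \<Delta> \<Gamma> \<phi> \<psi>))"
      using assms(1-6) A' A'' \<psi>
      by (simp add: pr1_lift_cmp[OF _ assms(2-5,7)] pr1_lift[OF assms(1,2) A' assms(6,8)]
          pr1_lift[OF _ _ _ _ A''_eq] cmp_assoc)
    show "msub C (ext C \<Theta> A'') (ext C \<Gamma> A)
        (cmp C (ext C \<Theta> A'') (ext C \<Delta> A') (ext C \<Gamma> A) (lift \<Delta> \<Gamma> A \<phi>) (lift \<Theta> \<Delta> A' \<psi>))
        (osub1 \<Gamma> A A) (pr2 C \<Gamma> A) =
      msub C (ext C \<Theta> A'') (ext C \<Gamma> A) (lift \<Theta> \<Gamma> A (cmp C \<Theta> \<Delta> \<Gamma> \<phi> \<psi>)) (osub1 \<Gamma> A A) (pr2 C \<Gamma> A)"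
      using assms(1-6) A' A'' \<psi>
      by (simp add: pr2_lift_cmp[OF _ assms(2-5,7)] pr2_lift[OF assms(1,2) A' assms(6,8)]
          pr2_lift[OF _ _ _ _ A''_eq])
  qed (use assms(1-6) A' A'' \<phi> \<psi> \<phi>\<psi> in simp_all)
qed

lemma lift_ide:
  assumes "\<Gamma> \<in> obj C" "A \<in> dobj C \<Gamma>"
  shows "lift \<Gamma> \<Gamma> A (ide C \<Gamma>) = ide C (ext C \<Gamma> A)"
proof -
  note A = osub_ide[OF assms, symmetric]
  show ?thesis
    by (rule ext_eqI[of "ext C \<Gamma> A" \<Gamma> A])
      (use assms in \<open>simp_all add: lift_in[OF _ _ _ _ A] pr1_lift[OF _ _ _ _ A] pr2_lift[OF _ _ _ _ A]\<close>)
qed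


subsection \<open>Change of base\<close>

text \<open>Substitution along an arbitrary \<phi>; weakening is the instance \<phi> = pi_1.\<close>

definition reindex :: "'o \<Rightarrow> 'o \<Rightarrow> 'm \<Rightarrow> ('d, 'e, 'd, 'e) functor_data" where
  "reindex \<Delta> \<Gamma> \<phi> =
     \<lparr>fobj = (\<lambda>A. osub C \<Delta> \<Gamma> \<phi> A),
      fmor = (\<lambda>A A' g. msub C (ext C \<Delta> (osub C \<Delta> \<Gamma> \<phi> A)) (ext C \<Gamma> A) (lift \<Delta> \<Gamma> A \<phi>) (osub1 \<Gamma> A A') g)\<rparr>"

text \<open>Both composites in the square have components \<phi> o pi_1 and g{\<phi>^+}. The square
  is why reindexing preserves composites: <pi_1,f> o \<phi>^+ becomes \<phi>^+ composed with the
  total map of the reindexed f.\<close>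

lemma
  assumes "\<Delta> \<in> obj C" "\<Gamma> \<in> obj C" "\<phi> \<in> hom C \<Delta> \<Gamma>" "A \<in> dobj C \<Gamma>" "A' \<in> dobj C \<Gamma>"
    "g \<in> dmor C (ext C \<Gamma> A) (osub1 \<Gamma> A A')"
  shows reindex_in: "fmor (reindex \<Delta> \<Gamma> \<phi>) A A' g \<in>
      dmor C (ext C \<Delta> (osub C \<Delta> \<Gamma> \<phi> A)) (osub1 \<Delta> (osub C \<Delta> \<Gamma> \<phi> A) (osub C \<Delta> \<Gamma> \<phi> A'))"
    and lift_total_reindex:
      "cmp C (ext C \<Delta> (osub C \<Delta> \<Gamma> \<phi> A)) (ext C \<Delta> (osub C \<Delta> \<Gamma> \<phi> A')) (ext C \<Gamma> A') (lift \<Delta> \<Gamma> A' \<phi>)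
        (total \<Delta> (osub C \<Delta> \<Gamma> \<phi> A) (osub C \<Delta> \<Gamma> \<phi> A') (fmor (reindex \<Delta> \<Gamma> \<phi>) A A' g)) =
       cmp C (ext C \<Delta> (osub C \<Delta> \<Gamma> \<phi> A)) (ext C \<Gamma> A) (ext C \<Gamma> A') (total \<Gamma> A A' g) (lift \<Delta> \<Gamma> A \<phi>)"
proof -
  let ?A = "osub C \<Delta> \<Gamma> \<phi> A" and ?A' = "osub C \<Delta> \<Gamma> \<phi> A'"
  have l: "lift \<Delta> \<Gamma> A \<phi> \<in> hom C (ext C \<Delta> ?A) (ext C \<Gamma> A)"
    and l': "lift \<Delta> \<Gamma> A' \<phi> \<in> hom C (ext C \<Delta> ?A') (ext C \<Gamma> A')"
    using assms by (simp_all add: lift_in)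
  have pr1_l: "cmp C (ext C \<Delta> ?A) (ext C \<Gamma> A) \<Gamma> (pr1 C \<Gamma> A) (lift \<Delta> \<Gamma> A \<phi>) =
      cmp C (ext C \<Delta> ?A) \<Delta> \<Gamma> \<phi> (pr1 C \<Delta> ?A)"
    using assms by (simp add: pr1_lift)
  show g: "fmor (reindex \<Delta> \<Gamma> \<phi>) A A' g \<in> dmor C (ext C \<Delta> ?A) (osub1 \<Delta> ?A ?A')"
    unfolding reindex_def using assms l
    by (simp, intro msub_in') (simp_all add: pr1_l, simp add: osub1_def)
  show "cmp C (ext C \<Delta> ?A) (ext C \<Delta> ?A') (ext C \<Gamma> A') (lift \<Delta> \<Gamma> A' \<phi>)
        (total \<Delta> ?A ?A' (fmor (reindex \<Delta> \<Gamma> \<phi>) A A' g)) =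
       cmp C (ext C \<Delta> ?A) (ext C \<Gamma> A) (ext C \<Gamma> A') (total \<Gamma> A A' g) (lift \<Delta> \<Gamma> A \<phi>)"
  proof (rule ext_eqI[of "ext C \<Delta> ?A" \<Gamma> A'])
    show "msub C (ext C \<Delta> ?A) (ext C \<Gamma> A')
        (cmp C (ext C \<Delta> ?A) (ext C \<Delta> ?A') (ext C \<Gamma> A') (lift \<Delta> \<Gamma> A' \<phi>)
          (total \<Delta> ?A ?A' (fmor (reindex \<Delta> \<Gamma> \<phi>) A A' g))) (osub1 \<Gamma> A' A') (pr2 C \<Gamma> A') =
      msub C (ext C \<Delta> ?A) (ext C \<Gamma> A')
        (cmp C (ext C \<Delta> ?A) (ext C \<Gamma> A) (ext C \<Gamma> A') (total \<Gamma> A A' g) (lift \<Delta> \<Gamma> A \<phi>))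
        (osub1 \<Gamma> A' A') (pr2 C \<Gamma> A')"
      using assms g l by (simp add: pr2_lift_cmp pr2_total_cmp) (simp add: reindex_def)
  qed (use assms g l l' in \<open>simp_all add: pr1_lift_cmp pr1_l\<close>)
qed

lemma is_functor_reindex:
  assumes "\<Delta> \<in> obj C" "\<Gamma> \<in> obj C" "\<phi> \<in> hom C \<Delta> \<Gamma>"
  shows "is_functor (slice \<Gamma>) (slice \<Delta>) (reindex \<Delta> \<Gamma> \<phi>)"
  unfolding is_functor_def
proof (intro conjI ballI)
  fix X Y Z f g
  assume *: "X \<in> obj (slice \<Gamma>)" "Y \<in> obj (slice \<Gamma>)" "Z \<in> obj (slice \<Gamma>)"
    "f \<in> hom (slice \<Gamma>) X Y" "g \<in> hom (slice \<Gamma>) Y Z"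
  let ?s = "osub C \<Delta> \<Gamma> \<phi>"
  have l: "lift \<Delta> \<Gamma> A \<phi> \<in> hom C (ext C \<Delta> (?s A)) (ext C \<Gamma> A)" if "A \<in> dobj C \<Gamma>" for A
    using assms that by (simp add: lift_in)
  have f: "fmor (reindex \<Delta> \<Gamma> \<phi>) X Y f \<in> dmor C (ext C \<Delta> (?s X)) (osub1 \<Delta> (?s X) (?s Y))"
    using reindex_in[OF assms] * by simp
  have ty: "osub C (ext C \<Delta> (?s Y)) (ext C \<Gamma> Y) (lift \<Delta> \<Gamma> Y \<phi>) (osub1 \<Gamma> Y Z) = osub1 \<Delta> (?s Y) (?s Z)"
    using * assms l[of Y] by (simp add: pr1_lift) (simp add: osub1_def)
  have "fmor (reindex \<Delta> \<Gamma> \<phi>) X Z (cmp (slice \<Gamma>) X Y Z g f) =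
      msub C (ext C \<Delta> (?s X)) (ext C \<Gamma> Y)
        (cmp C (ext C \<Delta> (?s X)) (ext C \<Gamma> X) (ext C \<Gamma> Y) (total \<Gamma> X Y f) (lift \<Delta> \<Gamma> X \<phi>))
        (osub1 \<Gamma> Y Z) g"
    using * assms l[of X] by (simp add: reindex_def msub_msub osub_total del: osub_osub1)
  also have "\<dots> = msub C (ext C \<Delta> (?s X)) (ext C \<Gamma> Y)
        (cmp C (ext C \<Delta> (?s X)) (ext C \<Delta> (?s Y)) (ext C \<Gamma> Y) (lift \<Delta> \<Gamma> Y \<phi>)
          (total \<Delta> (?s X) (?s Y) (fmor (reindex \<Delta> \<Gamma> \<phi>) X Y f)))
        (osub1 \<Gamma> Y Z) g"
    using * assms by (simp add: lift_total_reindex)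
  also have "\<dots> = cmp (slice \<Delta>) (?s X) (?s Y) (?s Z)
      (fmor (reindex \<Delta> \<Gamma> \<phi>) Y Z g) (fmor (reindex \<Delta> \<Gamma> \<phi>) X Y f)"
    using * assms f l[of Y] by (subst msub_cmp) (simp_all add: ty reindex_def del: osub_osub1)
  finally show "fmor (reindex \<Delta> \<Gamma> \<phi>) X Z (cmp (slice \<Gamma>) X Y Z g f) =
      cmp (slice \<Delta>) (fobj (reindex \<Delta> \<Gamma> \<phi>) X) (fobj (reindex \<Delta> \<Gamma> \<phi>) Y) (fobj (reindex \<Delta> \<Gamma> \<phi>) Z)
      (fmor (reindex \<Delta> \<Gamma> \<phi>) Y Z g) (fmor (reindex \<Delta> \<Gamma> \<phi>) X Y f)"
    by (simp add: reindex_def)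
next
  fix X assume "X \<in> obj (slice \<Gamma>)"
  then show "fmor (reindex \<Delta> \<Gamma> \<phi>) X X (ide (slice \<Gamma>) X) =
      ide (slice \<Delta>) (fobj (reindex \<Delta> \<Gamma> \<phi>) X)"
    using assms by (simp add: reindex_def pr2_lift)
next
  fix X Y f assume "X \<in> obj (slice \<Gamma>)" "Y \<in> obj (slice \<Gamma>)" "f \<in> hom (slice \<Gamma>) X Y"
  then show "fmor (reindex \<Delta> \<Gamma> \<phi>) X Y f \<in>
      hom (slice \<Delta>) (fobj (reindex \<Delta> \<Gamma> \<phi>) X) (fobj (reindex \<Delta> \<Gamma> \<phi>) Y)"
    using reindex_in[OF assms, of X Y f] by (simp add: reindex_def)
qed (use assms in \<open>simp_all add: category_slice, simp add: reindex_def\<close>)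

text \<open>Substitution is contravariantly functorial, so mutually inverse context morphisms act by
  mutually inverse maps. It supplies the bijections for \<open>pair_iso\<close> and for
  \<open>swap\<close>.\<close>

lemma bij_betw_msub:
  assumes "\<Theta> \<in> obj C" "\<Delta> \<in> obj C" "A \<in> dobj C \<Delta>" "u \<in> hom C \<Theta> \<Delta>" "v \<in> hom C \<Delta> \<Theta>"
    "cmp C \<Theta> \<Delta> \<Theta> v u = ide C \<Theta>" "cmp C \<Delta> \<Theta> \<Delta> u v = ide C \<Delta>" "A' = osub C \<Theta> \<Delta> u A"
  shows "bij_betw (msub C \<Theta> \<Delta> u A) (dmor C \<Delta> A) (dmor C \<Theta> A')"
proof (rule bij_betw_byWitness[where f' = "msub C \<Delta> \<Theta> v A'"])
  show "msub C \<Theta> \<Delta> u A ` dmor C \<Delta> A \<subseteq> dmor C \<Theta> A'"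
    using assms by auto
  show "msub C \<Delta> \<Theta> v A' ` dmor C \<Theta> A' \<subseteq> dmor C \<Delta> A"
    using assms by (auto intro!: msub_in')
  show "\<forall>a \<in> dmor C \<Delta> A. msub C \<Delta> \<Theta> v A' (msub C \<Theta> \<Delta> u A a) = a"
    using assms by (simp add: msub_msub)
  have "msub C \<Theta> \<Delta> u A (msub C \<Delta> \<Theta> v A' b) = b" if "b \<in> dmor C \<Theta> A'" for b
    using assms that by (subst msub_msub) simp_all
  then show "\<forall>b \<in> dmor C \<Theta> A'. msub C \<Theta> \<Delta> u A (msub C \<Delta> \<Theta> v A' b) = b"
    by blast
qed

end


section \<open>Dependent sums\<close>

context cccwd
begin

lemma weakening_functor_eq: "weakening_functor \<Gamma> B = reindex (ext C \<Gamma> B) \<Gamma> (pr1 C \<Gamma> B)"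
  by (simp add: weakening_functor_def reindex_def osub1_def[of \<Gamma> B])

text \<open>\<open>unpair \<Gamma> A B\<close> is \<open>\<langle>\<langle>\<pi>\<^sub>1, \<varpi>\<^sub>1\<rangle>, \<varpi>\<^sub>2\<rangle> : \<Gamma>.\<Sigma>(A,B) \<rightarrow> \<Gamma>.A.B\<close>.\<close>

definition unpair :: "'o \<Rightarrow> 'd \<Rightarrow> 'd \<Rightarrow> 'm" where
  "unpair \<Gamma> A B = (let S = SigmaD C \<Gamma> A B; E = ext C \<Gamma> S in
     pair E (ext C \<Gamma> A) B (pair E \<Gamma> A (pr1 C \<Gamma> S) (spr1 C \<Gamma> A B)) (spr2 C \<Gamma> A B))"

section \<open>The isomorphism between \<Gamma>.A.B and \<Gamma>.\<Sigma>(A,B)\<close>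

context
  fixes \<Gamma> A B
  assumes \<Gamma>: "\<Gamma> \<in> obj C" and A: "A \<in> dobj C \<Gamma>" and B: "B \<in> dobj C (ext C \<Gamma> A)"
begin

private abbreviation (input) "GA \<equiv> ext C \<Gamma> A"
private abbreviation (input) "GAB \<equiv> ext C (ext C \<Gamma> A) B"
private abbreviation (input) "SAB \<equiv> SigmaD C \<Gamma> A B"
private abbreviation (input) "GS \<equiv> ext C \<Gamma> (SigmaD C \<Gamma> A B)"

lemma Sigma_in: "SAB \<in> dobj C \<Gamma>"
  and spr1_in: "spr1 C \<Gamma> A B \<in> dmor C GS (osub1 \<Gamma> SAB A)"
  and spr2_in: "spr2 C \<Gamma> A B \<in> dmor C GS
    (osub C GS GA (pair GS \<Gamma> A (pr1 C \<Gamma> SAB) (spr1 C \<Gamma> A B)) B)"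
  using sigma[OF \<Gamma> A B] by (simp_all add: is_sigma_def)

lemma unpair1_in: "pair GS \<Gamma> A (pr1 C \<Gamma> SAB) (spr1 C \<Gamma> A B) \<in> hom C GS GA"
  using \<Gamma> A Sigma_in spr1_in by (simp add: osub1_def)

lemma unpair_in: "unpair \<Gamma> A B \<in> hom C GS GAB"
  using \<Gamma> A B Sigma_in unpair1_in spr2_in by (simp add: unpair_def Let_def)

text \<open>Stated after an arbitrary u because these equations serve to recover pi_1 o u,
  \<varpi>_1{u} and \<varpi>_2{u} from \<open>unpair\<close> o u.\<close>

lemma
  assumes "\<Theta> \<in> obj C" "u \<in> hom C \<Theta> GS"
  shows pr1_unpair_cmp: "cmp C \<Theta> GAB GA (pr1 C GA B) (cmp C \<Theta> GS GAB (unpair \<Gamma> A B) u) =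
      cmp C \<Theta> GS GA (pair GS \<Gamma> A (pr1 C \<Gamma> SAB) (spr1 C \<Gamma> A B)) u"
    and spr1_unpair_cmp: "msub C \<Theta> GA (cmp C \<Theta> GAB GA (pr1 C GA B) (cmp C \<Theta> GS GAB (unpair \<Gamma> A B) u))
        (osub1 \<Gamma> A A) (pr2 C \<Gamma> A) = msub C \<Theta> GS u (osub1 \<Gamma> SAB A) (spr1 C \<Gamma> A B)"
    and pr1_pr1_unpair_cmp: "cmp C \<Theta> GA \<Gamma> (pr1 C \<Gamma> A)
        (cmp C \<Theta> GAB GA (pr1 C GA B) (cmp C \<Theta> GS GAB (unpair \<Gamma> A B) u)) =
      cmp C \<Theta> GS \<Gamma> (pr1 C \<Gamma> SAB) u"
    and pr2_unpair_cmp: "msub C \<Theta> GAB (cmp C \<Theta> GS GAB (unpair \<Gamma> A B) u) (osub1 GA B B) (pr2 C GA B) =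
      msub C \<Theta> GS u (osub C GS GA (pair GS \<Gamma> A (pr1 C \<Gamma> SAB) (spr1 C \<Gamma> A B)) B) (spr2 C \<Gamma> A B)"
proof -
  note ty = assms \<Gamma> A B Sigma_in spr1_in spr2_in unpair1_in unpair_in
  have w1: "spr1 C \<Gamma> A B \<in> dmor C GS (osub C GS \<Gamma> (pr1 C \<Gamma> SAB) A)"
    using spr1_in by (simp add: osub1_def)
  show 1: "cmp C \<Theta> GAB GA (pr1 C GA B) (cmp C \<Theta> GS GAB (unpair \<Gamma> A B) u) =
      cmp C \<Theta> GS GA (pair GS \<Gamma> A (pr1 C \<Gamma> SAB) (spr1 C \<Gamma> A B)) u"
    unfolding unpair_def Let_def using ty by simp
  show "msub C \<Theta> GA (cmp C \<Theta> GAB GA (pr1 C GA B) (cmp C \<Theta> GS GAB (unpair \<Gamma> A B) u))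
        (osub1 \<Gamma> A A) (pr2 C \<Gamma> A) = msub C \<Theta> GS u (osub1 \<Gamma> SAB A) (spr1 C \<Gamma> A B)"
    unfolding 1 using ty w1 by (subst msub_cmp) (simp_all, simp add: osub1_def)
  show "cmp C \<Theta> GA \<Gamma> (pr1 C \<Gamma> A)
        (cmp C \<Theta> GAB GA (pr1 C GA B) (cmp C \<Theta> GS GAB (unpair \<Gamma> A B) u)) =
      cmp C \<Theta> GS \<Gamma> (pr1 C \<Gamma> SAB) u"
    unfolding 1 using ty w1 by simp
  show "msub C \<Theta> GAB (cmp C \<Theta> GS GAB (unpair \<Gamma> A B) u) (osub1 GA B B) (pr2 C GA B) =
      msub C \<Theta> GS u (osub C GS GA (pair GS \<Gamma> A (pr1 C \<Gamma> SAB) (spr1 C \<Gamma> A B)) B) (spr2 C \<Gamma> A B)"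
    using ty unfolding unpair_def Let_def by (subst msub_cmp) simp_all
qed

lemma dpair_ex1:
  assumes "\<Delta> \<in> obj C" "\<phi> \<in> hom C \<Delta> \<Gamma>" "g \<in> dmor C \<Delta> (osub C \<Delta> \<Gamma> \<phi> A)"
    "h \<in> dmor C \<Delta> (osub C \<Delta> GA (pair \<Delta> \<Gamma> A \<phi> g) B)"
  shows "\<exists>!k. is_dpair \<Delta> \<Gamma> A B SAB (spr1 C \<Gamma> A B) (spr2 C \<Gamma> A B) \<phi> g h k"
  using sigma[OF \<Gamma> A B] assms unfolding is_sigma_def by blast

text \<open>This is the uniqueness half of the \<Sigma>-space. The composite determines \<phi> =
  pi_1 o u, g = \<varpi>_1{u} and h = \<varpi>_2{u}; and pi_2{u} solves the equations that define
  [g,h], hence is the only solution. So both components of u are determined.\<close>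

lemma unpair_mono:
  assumes "\<Theta> \<in> obj C" and u: "u \<in> hom C \<Theta> GS" and v: "v \<in> hom C \<Theta> GS"
    and eq: "cmp C \<Theta> GS GAB (unpair \<Gamma> A B) u = cmp C \<Theta> GS GAB (unpair \<Gamma> A B) v"
  shows "u = v"
proof -
  note ty = \<Gamma> A B Sigma_in spr1_in spr2_in unpair1_in unpair_in assms(1)
  let ?T = "osub C GS GA (pair GS \<Gamma> A (pr1 C \<Gamma> SAB) (spr1 C \<Gamma> A B)) B"
  let ?\<phi> = "cmp C \<Theta> GS \<Gamma> (pr1 C \<Gamma> SAB) u"
  let ?g = "msub C \<Theta> GS u (osub1 \<Gamma> SAB A) (spr1 C \<Gamma> A B)"
  let ?h = "msub C \<Theta> GS u ?T (spr2 C \<Gamma> A B)"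
  have \<phi>: "?\<phi> = cmp C \<Theta> GS \<Gamma> (pr1 C \<Gamma> SAB) v"
    using pr1_pr1_unpair_cmp[OF assms(1) u] pr1_pr1_unpair_cmp[OF assms(1) v] eq by simp
  have g: "?g = msub C \<Theta> GS v (osub1 \<Gamma> SAB A) (spr1 C \<Gamma> A B)"
    using spr1_unpair_cmp[OF assms(1) u] spr1_unpair_cmp[OF assms(1) v] eq by simp
  have h: "?h = msub C \<Theta> GS v ?T (spr2 C \<Gamma> A B)"
    using pr2_unpair_cmp[OF assms(1) u] pr2_unpair_cmp[OF assms(1) v] eq by simp
  have g_in: "?g \<in> dmor C \<Theta> (osub C \<Theta> \<Gamma> ?\<phi> A)"
    using ty u by (intro msub_in') simp_all
  have "pair \<Theta> \<Gamma> A ?\<phi> ?g = cmp C \<Theta> GS GA (pair GS \<Gamma> A (pr1 C \<Gamma> SAB) (spr1 C \<Gamma> A B)) u"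
    using ty u by (subst pair_cmp) (simp_all add: osub1_def)
  then have h_in: "?h \<in> dmor C \<Theta> (osub C \<Theta> GA (pair \<Theta> \<Gamma> A ?\<phi> ?g) B)"
    using ty u by (intro msub_in') simp_all
  \<comment> \<open>By eta, <pi_1 o u, pi_2{u}> is u itself, so the two equations read \<varpi>_1{u}
    = g and \<varpi>_2{u} = h, which is how g and h were chosen.\<close>
  have "is_dpair \<Theta> \<Gamma> A B SAB (spr1 C \<Gamma> A B) (spr2 C \<Gamma> A B) ?\<phi> ?g ?h
      (msub C \<Theta> GS u (osub1 \<Gamma> SAB SAB) (pr2 C \<Gamma> SAB))"
    unfolding is_dpair_def using ty u by (simp add: pair_eta)
  moreover have "is_dpair \<Theta> \<Gamma> A B SAB (spr1 C \<Gamma> A B) (spr2 C \<Gamma> A B) ?\<phi> ?g ?h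
      (msub C \<Theta> GS v (osub1 \<Gamma> SAB SAB) (pr2 C \<Gamma> SAB))"
    unfolding is_dpair_def \<phi> g h using ty v by (simp add: pair_eta)
  moreover have "?\<phi> \<in> hom C \<Theta> \<Gamma>" using ty u by simp
  ultimately have "msub C \<Theta> GS u (osub1 \<Gamma> SAB SAB) (pr2 C \<Gamma> SAB) = msub C \<Theta> GS v (osub1 \<Gamma> SAB SAB) (pr2 C \<Gamma> SAB)"
    using dpair_ex1[OF assms(1) _ g_in h_in] by blast
  with \<phi> show "u = v"
    by (rule ext_eqI[OF assms(1) \<Gamma> Sigma_in u v])
qed

text \<open>The existence half of the \<Sigma>-space, with both equations for [g,h] packed into one
  equation of context morphisms.\<close>

lemma
  assumes "\<Delta> \<in> obj C" "\<phi> \<in> hom C \<Delta> \<Gamma>" "g \<in> dmor C \<Delta> (osub C \<Delta> \<Gamma> \<phi> A)"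
    "h \<in> dmor C \<Delta> (osub C \<Delta> GA (pair \<Delta> \<Gamma> A \<phi> g) B)"
  shows dpair_in: "dpair \<Delta> \<Gamma> A B \<phi> g h \<in> dmor C \<Delta> (osub C \<Delta> \<Gamma> \<phi> SAB)"
    and unpair_dpair: "cmp C \<Delta> GS GAB (unpair \<Gamma> A B) (pair \<Delta> \<Gamma> SAB \<phi> (dpair \<Delta> \<Gamma> A B \<phi> g h)) =
      pair \<Delta> GA B (pair \<Delta> \<Gamma> A \<phi> g) h"
proof -
  note ty = \<Gamma> A B Sigma_in spr1_in spr2_in unpair1_in unpair_in assms
  let ?k = "dpair \<Delta> \<Gamma> A B \<phi> g h"
  have k: "is_dpair \<Delta> \<Gamma> A B SAB (spr1 C \<Gamma> A B) (spr2 C \<Gamma> A B) \<phi> g h ?k"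
    unfolding dpair_def by (rule theI'[OF dpair_ex1[OF assms]])
  then show k_in: "?k \<in> dmor C \<Delta> (osub C \<Delta> \<Gamma> \<phi> SAB)"
    by (simp add: is_dpair_def)
  let ?u = "pair \<Delta> \<Gamma> SAB \<phi> ?k"
  have u: "?u \<in> hom C \<Delta> GS" using ty k_in by simp
  have w1: "spr1 C \<Gamma> A B \<in> dmor C GS (osub C GS \<Gamma> (pr1 C \<Gamma> SAB) A)"
    using spr1_in by (simp add: osub1_def)
  have "cmp C \<Delta> GS GA (pair GS \<Gamma> A (pr1 C \<Gamma> SAB) (spr1 C \<Gamma> A B)) ?u = pair \<Delta> \<Gamma> A \<phi> g"
    using ty k k_in u w1 by (subst pair_cmp) (simp_all add: is_dpair_def osub1_def)
  then show "cmp C \<Delta> GS GAB (unpair \<Gamma> A B) ?u = pair \<Delta> GA B (pair \<Delta> \<Gamma> A \<phi> g) h"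
    using ty k u unfolding unpair_def Let_def by (subst pair_cmp) (simp_all add: is_dpair_def)
qed

lemma
  shows pair_iso_in: "pair_iso \<Gamma> A B \<in> hom C GAB GS"
    and unpair_pair_iso: "cmp C GAB GS GAB (unpair \<Gamma> A B) (pair_iso \<Gamma> A B) = ide C GAB"
    and pr1_pair_iso: "cmp C GAB GS \<Gamma> (pr1 C \<Gamma> SAB) (pair_iso \<Gamma> A B) =
      cmp C GAB GA \<Gamma> (pr1 C \<Gamma> A) (pr1 C GA B)"
proof -
  note ty = \<Gamma> A B Sigma_in
  let ?q = "cmp C GAB GA \<Gamma> (pr1 C \<Gamma> A) (pr1 C GA B)"
  let ?g = "msub C GAB GA (pr1 C GA B) (osub1 \<Gamma> A A) (pr2 C \<Gamma> A)"
  have q: "?q \<in> hom C GAB \<Gamma>" and g: "?g \<in> dmor C GAB (osub C GAB \<Gamma> ?q A)"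
    using ty by simp_all
  \<comment> \<open>Eta for pi_1 : \<Gamma>.A.B -> \<Gamma>.A. It identifies the type that
    \<open>dpair\<close> expects of its last argument with the type of pi_2.\<close>
  have qg: "pair GAB \<Gamma> A ?q ?g = pr1 C GA B"
    using ty by (simp add: pair_eta)
  have h: "pr2 C GA B \<in> dmor C GAB (osub C GAB GA (pair GAB \<Gamma> A ?q ?g) B)"
    using ty pr2_in[of GA B] unfolding qg by (simp add: osub1_def)
  have GAB: "GAB \<in> obj C" using ty by simp
  note dp = dpair_in[OF GAB q g h]
  show "pair_iso \<Gamma> A B \<in> hom C GAB GS"
    "cmp C GAB GS \<Gamma> (pr1 C \<Gamma> SAB) (pair_iso \<Gamma> A B) = ?q"
    unfolding pair_iso_def Let_def using ty dp q by simp_all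
  have "pair GAB GA B (pr1 C GA B) (pr2 C GA B) = ide C GAB"
    using ty by (intro pair_unique) (simp_all, simp add: osub1_def[symmetric])
  then show "cmp C GAB GS GAB (unpair \<Gamma> A B) (pair_iso \<Gamma> A B) = ide C GAB"
    unfolding pair_iso_def Let_def unpair_dpair[OF GAB q g h] qg .
qed

text \<open>\<open>pair_iso\<close> is a right inverse of the monic \<open>unpair\<close>, hence
  also a left inverse.\<close>

lemma pair_iso_unpair: "cmp C GS GAB GS (pair_iso \<Gamma> A B) (unpair \<Gamma> A B) = ide C GS"
  by (rule unpair_mono[where \<Theta> = GS])
    (use \<Gamma> A B Sigma_in unpair_in pair_iso_in in \<open>simp_all add: unpair_pair_iso flip: cmp_assoc\<close>)

text \<open>\<open>pair_iso_inv\<close> is a definite description. A two-sided inverse is unique, so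
  it denotes \<open>unpair\<close>, whose components are explicit.\<close>

lemma pair_iso_inv_eq: "pair_iso_inv \<Gamma> A B = unpair \<Gamma> A B"
  unfolding pair_iso_inv_def inverse_mor_def
proof (rule the_equality)
  fix v
  assume v: "v \<in> hom C GS GAB \<and> cmp C GAB GS GAB v (pair_iso \<Gamma> A B) = ide C GAB \<and>
    cmp C GS GAB GS (pair_iso \<Gamma> A B) v = ide C GS"
  have "v = cmp C GS GAB GAB (cmp C GAB GS GAB (unpair \<Gamma> A B) (pair_iso \<Gamma> A B)) v"
    using v \<Gamma> A B Sigma_in by (simp add: unpair_pair_iso)
  also have "\<dots> = unpair \<Gamma> A B"
    using v \<Gamma> A B Sigma_in unpair_in pair_iso_in by (simp add: cmp_assoc)
  finally show "v = unpair \<Gamma> A B" .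
qed (simp add: unpair_in unpair_pair_iso pair_iso_unpair)

end

text \<open>The formula [\<varpi>_1, h{Pair^-1}] is <pi_1,h> conjugated by the isomorphisms Pair,
  and this is what naturality needs of \<Sigma>(B,h). Brackets are computed through
  \<open>unpair\<close>, so the square is obtained for \<open>unpair\<close> and then transferred to
  Pair.\<close>

lemma
  assumes \<Gamma>: "\<Gamma> \<in> obj C" and B: "B \<in> dobj C \<Gamma>"
    and X: "X \<in> dobj C (ext C \<Gamma> B)" and X': "X' \<in> dobj C (ext C \<Gamma> B)"
    and h: "h \<in> dmor C (ext C (ext C \<Gamma> B) X) (osub1 (ext C \<Gamma> B) X X')"
  shows Sigma_mor_in: "fmor (Sigma_functor \<Gamma> B) X X' h \<in>
      dmor C (ext C \<Gamma> (SigmaD C \<Gamma> B X)) (osub1 \<Gamma> (SigmaD C \<Gamma> B X) (SigmaD C \<Gamma> B X'))"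
    and total_Sigma_mor:
      "cmp C (ext C (ext C \<Gamma> B) X) (ext C \<Gamma> (SigmaD C \<Gamma> B X)) (ext C \<Gamma> (SigmaD C \<Gamma> B X'))
        (total \<Gamma> (SigmaD C \<Gamma> B X) (SigmaD C \<Gamma> B X') (fmor (Sigma_functor \<Gamma> B) X X' h))
        (pair_iso \<Gamma> B X) =
       cmp C (ext C (ext C \<Gamma> B) X) (ext C (ext C \<Gamma> B) X') (ext C \<Gamma> (SigmaD C \<Gamma> B X'))
        (pair_iso \<Gamma> B X') (total (ext C \<Gamma> B) X X' h)"
proof -
  let ?D = "ext C \<Gamma> B" and ?S = "SigmaD C \<Gamma> B X" and ?S' = "SigmaD C \<Gamma> B X'"
  let ?E = "ext C \<Gamma> ?S" and ?E' = "ext C \<Gamma> ?S'"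
  let ?u = "unpair \<Gamma> B X" and ?u' = "unpair \<Gamma> B X'"
  let ?p = "pair ?E \<Gamma> B (pr1 C \<Gamma> ?S) (spr1 C \<Gamma> B X)"
  let ?f = "fmor (Sigma_functor \<Gamma> B) X X' h"
  note ty = \<Gamma> B X X' h Sigma_in[OF \<Gamma> B X] Sigma_in[OF \<Gamma> B X'] unpair_in[OF \<Gamma> B X]
    unpair_in[OF \<Gamma> B X'] pair_iso_in[OF \<Gamma> B X] pair_iso_in[OF \<Gamma> B X'] unpair1_in[OF \<Gamma> B X]
  have pr1_u: "cmp C ?E (ext C ?D X) ?D (pr1 C ?D X) ?u = ?p"
    using pr1_unpair_cmp[OF \<Gamma> B X, of ?E "ide C ?E"] ty by simp
  have E: "?E \<in> obj C" and pr1: "pr1 C \<Gamma> ?S \<in> hom C ?E \<Gamma>"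
    using ty by simp_all
  have w1: "spr1 C \<Gamma> B X \<in> dmor C ?E (osub C ?E \<Gamma> (pr1 C \<Gamma> ?S) B)"
    using spr1_in[OF \<Gamma> B X] by (simp add: osub1_def)
  let ?h = "msub C ?E (ext C ?D X) ?u (osub1 ?D X X') h"
  have h': "?h \<in> dmor C ?E (osub C ?E ?D ?p X')"
    using ty by (intro msub_in') (simp_all add: pr1_u)
  have f_eq: "?f = dpair ?E \<Gamma> B X' (pr1 C \<Gamma> ?S) (spr1 C \<Gamma> B X) ?h"
    by (simp add: Sigma_functor_def Let_def pair_iso_inv_eq[OF \<Gamma> B X])
  show f: "?f \<in> dmor C ?E (osub1 \<Gamma> ?S ?S')"
    unfolding f_eq osub1_def[of \<Gamma>] by (rule dpair_in[OF \<Gamma> B X' E pr1 w1 h'])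
  have "cmp C ?E ?E' (ext C ?D X') ?u' (total \<Gamma> ?S ?S' ?f) = pair ?E ?D X' ?p ?h"
    unfolding f_eq total_def by (rule unpair_dpair[OF \<Gamma> B X' E pr1 w1 h'])
  also have "\<dots> = cmp C ?E (ext C ?D X) (ext C ?D X') (total ?D X X' h) ?u"
    using ty h' by (intro pair_unique) (simp_all add: pr1_u pr2_total_cmp)
  finally have eq: "cmp C ?E ?E' (ext C ?D X') ?u' (total \<Gamma> ?S ?S' ?f) =
      cmp C ?E (ext C ?D X) (ext C ?D X') (total ?D X X' h) ?u" .
  let ?DX = "ext C ?D X" and ?DX' = "ext C ?D X'"
  show "cmp C ?DX ?E ?E' (total \<Gamma> ?S ?S' ?f) (pair_iso \<Gamma> B X) =
       cmp C ?DX ?DX' ?E' (pair_iso \<Gamma> B X') (total ?D X X' h)"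
  \<comment> \<open>\<open>unpair\<close> is monic, so the square may be tested after composing with
    it, where both sides become <pi_1,h>.\<close>
  proof (rule unpair_mono[OF \<Gamma> B X'])
    have "cmp C ?DX ?E' ?DX' ?u' (cmp C ?DX ?E ?E' (total \<Gamma> ?S ?S' ?f) (pair_iso \<Gamma> B X)) =
        cmp C ?DX ?E ?DX' (cmp C ?E ?E' ?DX' ?u' (total \<Gamma> ?S ?S' ?f)) (pair_iso \<Gamma> B X)"
      using ty f by (simp add: cmp_assoc)
    also have "\<dots> = total ?D X X' h"
      unfolding eq using ty by (simp add: cmp_assoc unpair_pair_iso[OF \<Gamma> B X])
    also have "\<dots> = cmp C ?DX ?E' ?DX' ?u' (cmp C ?DX ?DX' ?E' (pair_iso \<Gamma> B X') (total ?D X X' h))"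
      using ty by (simp add: unpair_pair_iso[OF \<Gamma> B X'] flip: cmp_assoc)
    finally show "cmp C ?DX ?E' ?DX' ?u' (cmp C ?DX ?E ?E' (total \<Gamma> ?S ?S' ?f) (pair_iso \<Gamma> B X)) =
      cmp C ?DX ?E' ?DX' ?u' (cmp C ?DX ?DX' ?E' (pair_iso \<Gamma> B X') (total ?D X X' h))" .
  qed (use ty f in simp_all)
qed

text \<open>The known functor here is the right adjoint, by \<open>is_functor_reindex\<close>, so
  \<open>adjoint_leftI\<close> is the rule that fits. The transpose of k is k{Pair}.\<close>

lemma adjoint_Sigma_weakening:
  assumes \<Gamma>: "\<Gamma> \<in> obj C" and B: "B \<in> dobj C \<Gamma>"
  shows "adjoint (slice (ext C \<Gamma> B)) (slice \<Gamma>) (Sigma_functor \<Gamma> B) (weakening_functor \<Gamma> B)"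
proof (rule adjoint_leftI[where \<Phi> = "\<lambda>X Y k. msub C (ext C (ext C \<Gamma> B) X)
    (ext C \<Gamma> (SigmaD C \<Gamma> B X)) (pair_iso \<Gamma> B X) (osub1 \<Gamma> (SigmaD C \<Gamma> B X) Y) k"])
  let ?D = "ext C \<Gamma> B" and ?p = "pr1 C \<Gamma> B"
  have D: "?D \<in> obj C" and p: "?p \<in> hom C ?D \<Gamma>" using \<Gamma> B by simp_all
  have S_obj [simp]: "fobj (Sigma_functor \<Gamma> B) X = SigmaD C \<Gamma> B X" for X
    by (simp add: Sigma_functor_def)
  have W_obj [simp]: "fobj (weakening_functor \<Gamma> B) X = osub1 \<Gamma> B X" for X
    by (simp add: weakening_functor_def)
  show "is_functor (slice \<Gamma>) (slice ?D) (weakening_functor \<Gamma> B)"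
    unfolding weakening_functor_eq by (rule is_functor_reindex[OF D \<Gamma> p])
  show "fobj (Sigma_functor \<Gamma> B) X \<in> obj (slice \<Gamma>)" if "X \<in> obj (slice ?D)" for X
    using that Sigma_in[OF \<Gamma> B] by simp
  show "fmor (Sigma_functor \<Gamma> B) X X' u \<in>
      hom (slice \<Gamma>) (fobj (Sigma_functor \<Gamma> B) X) (fobj (Sigma_functor \<Gamma> B) X')"
    if "X \<in> obj (slice ?D)" "X' \<in> obj (slice ?D)" "u \<in> hom (slice ?D) X X'" for X X' u
    using that Sigma_mor_in[OF \<Gamma> B] by simp
  \<comment> \<open>Pair lies over \<Gamma>, so Y{pi_1}{Pair} = Y{pi_1}{pi_1}: the transpose has the
    type of a morphism into the weakening of Y.\<close>
  have ty_iso: "osub1 ?D X (osub1 \<Gamma> B Y) =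
      osub C (ext C ?D X) (ext C \<Gamma> (SigmaD C \<Gamma> B X)) (pair_iso \<Gamma> B X) (osub1 \<Gamma> (SigmaD C \<Gamma> B X) Y)"
    if X: "X \<in> dobj C ?D" and Y: "Y \<in> dobj C \<Gamma>" for X Y
    using \<Gamma> B D X Y Sigma_in[OF \<Gamma> B X] pair_iso_in[OF \<Gamma> B X]
    by (simp add: pr1_pair_iso[OF \<Gamma> B X] osub1_def[of ?D])
  {
    fix X Y assume "X \<in> obj (slice ?D)" "Y \<in> obj (slice \<Gamma>)"
    then have X: "X \<in> dobj C ?D" and Y: "Y \<in> dobj C \<Gamma>" by simp_all
    show "bij_betw (msub C (ext C ?D X) (ext C \<Gamma> (SigmaD C \<Gamma> B X)) (pair_iso \<Gamma> B X)
        (osub1 \<Gamma> (SigmaD C \<Gamma> B X) Y))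
      (hom (slice \<Gamma>) (fobj (Sigma_functor \<Gamma> B) X) Y)
      (hom (slice ?D) X (fobj (weakening_functor \<Gamma> B) Y))"
      unfolding slice_simps S_obj W_obj
      by (rule bij_betw_msub[where v = "unpair \<Gamma> B X"])
        (use \<Gamma> B X Y D Sigma_in[OF \<Gamma> B X] pair_iso_in[OF \<Gamma> B X] unpair_in[OF \<Gamma> B X]
          unpair_pair_iso[OF \<Gamma> B X] pair_iso_unpair[OF \<Gamma> B X] ty_iso[OF X Y] in simp_all)
  }
  fix X X' Y Y' u v k
  assume "X \<in> obj (slice ?D)" "X' \<in> obj (slice ?D)" "Y \<in> obj (slice \<Gamma>)" "Y' \<in> obj (slice \<Gamma>)"
    "u \<in> hom (slice ?D) X' X" "v \<in> hom (slice \<Gamma>) Y Y'"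
    "k \<in> hom (slice \<Gamma>) (fobj (Sigma_functor \<Gamma> B) X) Y"
  then have X: "X \<in> dobj C ?D" and X': "X' \<in> dobj C ?D"
    and Y: "Y \<in> dobj C \<Gamma>" and Y': "Y' \<in> dobj C \<Gamma>"
    and u: "u \<in> dmor C (ext C ?D X') (osub1 ?D X' X)"
    and v: "v \<in> dmor C (ext C \<Gamma> Y) (osub1 \<Gamma> Y Y')"
    and k: "k \<in> dmor C (ext C \<Gamma> (SigmaD C \<Gamma> B X)) (osub1 \<Gamma> (SigmaD C \<Gamma> B X) Y)"
    by simp_all
  let ?S = "SigmaD C \<Gamma> B X" and ?S' = "SigmaD C \<Gamma> B X'" and ?Y = "osub1 \<Gamma> B Y"
  let ?i = "pair_iso \<Gamma> B X" and ?i' = "pair_iso \<Gamma> B X'"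
  let ?E = "ext C \<Gamma> ?S" and ?E' = "ext C \<Gamma> ?S'" and ?DX = "ext C ?D X" and ?DX' = "ext C ?D X'"
  let ?Su = "fmor (Sigma_functor \<Gamma> B) X' X u" and ?l = "lift ?D \<Gamma> Y ?p"
  let ?k = "msub C ?DX ?E ?i (osub1 \<Gamma> ?S Y) k"
  have Y_eq: "?Y = osub C ?D \<Gamma> ?p Y"
    by (simp add: osub1_def)
  note l = lift_in[OF D \<Gamma> Y p Y_eq] and pr1_l = pr1_lift[OF D \<Gamma> Y p Y_eq]
  have ty_l: "osub C (ext C ?D ?Y) (ext C \<Gamma> Y) ?l (osub1 \<Gamma> Y Y') = osub1 ?D ?Y (osub1 \<Gamma> B Y')"
    using \<Gamma> B Y Y' D l by (simp add: pr1_l osub1_def[of ?D])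
  note ty = \<Gamma> B D p X X' Y Y' u v k l Sigma_in[OF \<Gamma> B X] Sigma_in[OF \<Gamma> B X']
    pair_iso_in[OF \<Gamma> B X] pair_iso_in[OF \<Gamma> B X'] Sigma_mor_in[OF \<Gamma> B X' X u]
  have k': "?k \<in> dmor C ?DX (osub1 ?D X ?Y)"
    using ty by (intro msub_in' ty_iso) simp_all
  \<comment> \<open>The transpose of k gives a map into \<Gamma>.B.Y{pi_1}. Projected to \<Gamma>.Y
    it is <pi_1,k> o Pair, since both have components pi_1 o pi_1 and k{Pair}.\<close>
  have square: "cmp C ?DX (ext C ?D ?Y) (ext C \<Gamma> Y) ?l (total ?D X ?Y ?k) =
      cmp C ?DX ?E (ext C \<Gamma> Y) (total \<Gamma> ?S Y k) ?i"
    by (rule ext_eqI[of ?DX \<Gamma> Y])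
      (use ty k' in \<open>simp_all add: pr1_lift_cmp[OF _ D \<Gamma> Y p Y_eq]
        pr2_lift_cmp[OF _ D \<Gamma> Y p Y_eq] pr1_pair_iso[OF \<Gamma> B X] pr2_total_cmp\<close>)
  have "msub C ?DX' ?E' ?i' (osub1 \<Gamma> ?S' Y')
      (msub C ?E' (ext C \<Gamma> Y) (total \<Gamma> ?S' Y (msub C ?E' ?E (total \<Gamma> ?S' ?S ?Su) (osub1 \<Gamma> ?S Y) k))
        (osub1 \<Gamma> Y Y') v) =
    msub C ?DX' (ext C \<Gamma> Y) (cmp C ?DX' ?E (ext C \<Gamma> Y) (total \<Gamma> ?S Y k)
      (cmp C ?DX' ?E' ?E (total \<Gamma> ?S' ?S ?Su) ?i')) (osub1 \<Gamma> Y Y') v"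
    using ty by (subst msub_msub)
      (simp_all add: total_slice_cmp cmp_assoc osub1_def[of \<Gamma> ?S'])
  \<comment> \<open>\<open>total_Sigma_mor\<close> moves Pair past \<Sigma>(B,u), which gives
    <pi_1,k> o Pair o <pi_1,u>; then \<open>square\<close> applies.\<close>
  also have "\<dots> = msub C ?DX' (ext C \<Gamma> Y) (cmp C ?DX' (ext C ?D ?Y) (ext C \<Gamma> Y) ?l
      (total ?D X' ?Y (msub C ?DX' ?DX (total ?D X' X u) (osub1 ?D X ?Y) ?k))) (osub1 \<Gamma> Y Y') v"
    using ty k' by (simp add: total_Sigma_mor[OF \<Gamma> B X' X u] total_slice_cmp square flip: cmp_assoc)
  also have "\<dots> = msub C ?DX' (ext C ?D ?Y)
      (total ?D X' ?Y (msub C ?DX' ?DX (total ?D X' X u) (osub1 ?D X ?Y) ?k))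
      (osub1 ?D ?Y (osub1 \<Gamma> B Y')) (msub C (ext C ?D ?Y) (ext C \<Gamma> Y) ?l (osub1 \<Gamma> Y Y') v)"
    using ty k' by (subst msub_cmp) (simp_all add: ty_l del: osub_osub1)
  finally show "msub C ?DX' ?E' ?i' (osub1 \<Gamma> ?S' Y')
      (cmp (slice \<Gamma>) (fobj (Sigma_functor \<Gamma> B) X') Y Y' v
        (cmp (slice \<Gamma>) (fobj (Sigma_functor \<Gamma> B) X') (fobj (Sigma_functor \<Gamma> B) X) Y k ?Su)) =
    cmp (slice ?D) X' (fobj (weakening_functor \<Gamma> B) Y) (fobj (weakening_functor \<Gamma> B) Y')
      (fmor (weakening_functor \<Gamma> B) Y Y' v)
      (cmp (slice ?D) X' X (fobj (weakening_functor \<Gamma> B) Y) ?k u)"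
    by (simp add: weakening_functor_def)
qed

end


section \<open>Dependent products\<close>

context sccwd
begin

text \<open>The inverse is evaluation of \<open>d\<close> along the lift of <id,k>. The equation in
  \<open>is_curry\<close> computes f from k, whence injectivity; conversely, evaluating at any k
  yields an f whose curried form is k by uniqueness.\<close>

lemma bij_betw_curry:
  assumes \<Gamma>: "\<Gamma> \<in> obj C" and A: "A \<in> dobj C \<Gamma>" and B: "B \<in> dobj C (ext C \<Gamma> A)"
    and P: "is_pseudo_pi \<Gamma> A B P d"
  shows "bij_betw (\<lambda>f. THE k. is_curry \<Gamma> A B P d f k) (dmor C (ext C \<Gamma> A) B) (dmor C \<Gamma> P)"
proof -
  let ?GP = "ext C \<Gamma> P" and ?GA = "ext C \<Gamma> A" and ?A = "osub1 \<Gamma> P A"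
  let ?l = "lift ?GP \<Gamma> A (pr1 C \<Gamma> P)" and ?s = "section_of \<Gamma> P"
  let ?l' = "\<lambda>k. lift \<Gamma> ?GP ?A (?s k)"
  have P_in: "P \<in> dobj C \<Gamma>" and d: "d \<in> dmor C (ext C ?GP ?A) (osub C (ext C ?GP ?A) ?GA ?l B)"
    and ex1: "\<And>f. f \<in> dmor C ?GA B \<Longrightarrow> \<exists>!k. is_curry \<Gamma> A B P d f k"
    using P by (auto simp: is_pseudo_pi_def)
  note curry = theI'[OF ex1]
  have curry_det: "f = f'" if "is_curry \<Gamma> A B P d f k" "is_curry \<Gamma> A B P d f' k" for f f' k
    using that by (simp add: is_curry_def)
  have ev: "\<exists>f \<in> dmor C ?GA B. is_curry \<Gamma> A B P d f k" if k: "k \<in> dmor C \<Gamma> P" for k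
  proof -
    have GP: "?GP \<in> obj C" and p: "pr1 C \<Gamma> P \<in> hom C ?GP \<Gamma>" and A1: "?A \<in> dobj C ?GP"
      and A1_eq: "?A = osub C ?GP \<Gamma> (pr1 C \<Gamma> P) A"
      using \<Gamma> A P_in by (simp_all add: osub1_def)
    have s: "?s k \<in> hom C \<Gamma> ?GP" and pr1_s: "cmp C \<Gamma> ?GP \<Gamma> (pr1 C \<Gamma> P) (?s k) = ide C \<Gamma>"
      using \<Gamma> P_in k by (simp_all add: section_of_def)
    have A_eq: "A = osub C \<Gamma> ?GP (?s k) ?A"
      using \<Gamma> A P_in s pr1_s by simp
    note l = lift_in[OF GP \<Gamma> A p A1_eq] and l' = lift_in[OF \<Gamma> GP A1 s A_eq]
    \<comment> \<open>As pi_1 o <id,k> = id, the two lifts compose to an identity. The evaluated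
      \<open>d\<close> has as type B substituted along that composite, that is B.\<close>
    have "cmp C ?GA (ext C ?GP ?A) ?GA ?l (?l' k) = ide C ?GA"
      using lift_cmp[OF \<Gamma> GP \<Gamma> A p s A1_eq A_eq] \<Gamma> A by (simp add: pr1_s lift_ide)
    then have "B = osub C ?GA (ext C ?GP ?A) (?l' k) (osub C (ext C ?GP ?A) ?GA ?l B)"
      using \<Gamma> A B GP A1 l l' by simp
    then have "msub C ?GA (ext C ?GP ?A) (?l' k) (osub C (ext C ?GP ?A) ?GA ?l B) d \<in> dmor C ?GA B"
      using \<Gamma> A B GP A1 l l' d by (intro msub_in') simp_all
    then show ?thesis
      using k by (auto simp: is_curry_def)
  qed
  show ?thesis
    unfolding bij_betw_def
  proof
    show "inj_on (\<lambda>f. THE k. is_curry \<Gamma> A B P d f k) (dmor C ?GA B)"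
    proof (rule inj_onI)
      fix f f' assume *: "f \<in> dmor C ?GA B" "f' \<in> dmor C ?GA B"
        "(THE k. is_curry \<Gamma> A B P d f k) = (THE k. is_curry \<Gamma> A B P d f' k)"
      show "f = f'"
        using curry[OF *(1)] curry[OF *(2)] unfolding *(3) by (rule curry_det)
    qed
    show "(\<lambda>f. THE k. is_curry \<Gamma> A B P d f k) ` dmor C ?GA B = dmor C \<Gamma> P"
    proof (intro equalityI subsetI)
      fix k assume "k \<in> (\<lambda>f. THE k. is_curry \<Gamma> A B P d f k) ` dmor C ?GA B"
      then obtain f where f: "f \<in> dmor C ?GA B" "k = (THE k. is_curry \<Gamma> A B P d f k)" by blast
      show "k \<in> dmor C \<Gamma> P"
        using curry[OF f(1)] unfolding f(2)[symmetric] by (simp add: is_curry_def)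
    next
      fix k assume "k \<in> dmor C \<Gamma> P"
      then obtain f where f: "f \<in> dmor C ?GA B" "is_curry \<Gamma> A B P d f k" using ev by blast
      then show "k \<in> (\<lambda>f. THE k. is_curry \<Gamma> A B P d f k) ` dmor C ?GA B"
        using the1_equality[OF ex1[OF f(1)] f(2)] by (intro image_eqI[where x = f]) simp_all
    qed
  qed
qed

text \<open>The exchange of variables \<open>\<Gamma>.A.B{\<pi>\<^sub>1} \<rightarrow> \<Gamma>.B.A{\<pi>\<^sub>1}\<close>.\<close>

definition swap :: "'o \<Rightarrow> 'd \<Rightarrow> 'd \<Rightarrow> 'm" where
  "swap \<Gamma> A B = (let GA = ext C \<Gamma> A; E = ext C GA (osub1 \<Gamma> A B) in
     pair E (ext C \<Gamma> B) (osub1 \<Gamma> B A) (lift GA \<Gamma> B (pr1 C \<Gamma> A))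
       (msub C E GA (pr1 C GA (osub1 \<Gamma> A B)) (osub1 \<Gamma> A A) (pr2 C \<Gamma> A)))"

text \<open>Both contexts are pullbacks of \<Gamma>.A and \<Gamma>.B over \<Gamma>, with pi_1 and
  the lift of pi_1 as projections; \<open>pr1_swap\<close> and \<open>lift_swap\<close> say that the
  exchange interchanges the two.\<close>

lemma
  assumes \<Gamma>: "\<Gamma> \<in> obj C" and A: "A \<in> dobj C \<Gamma>" and B: "B \<in> dobj C \<Gamma>"
  shows swap_in: "swap \<Gamma> A B \<in>
      hom C (ext C (ext C \<Gamma> A) (osub1 \<Gamma> A B)) (ext C (ext C \<Gamma> B) (osub1 \<Gamma> B A))"
    and pr1_swap: "cmp C (ext C (ext C \<Gamma> A) (osub1 \<Gamma> A B)) (ext C (ext C \<Gamma> B) (osub1 \<Gamma> B A))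
        (ext C \<Gamma> B) (pr1 C (ext C \<Gamma> B) (osub1 \<Gamma> B A)) (swap \<Gamma> A B) =
      lift (ext C \<Gamma> A) \<Gamma> B (pr1 C \<Gamma> A)"
    and pr2_swap: "msub C (ext C (ext C \<Gamma> A) (osub1 \<Gamma> A B)) (ext C (ext C \<Gamma> B) (osub1 \<Gamma> B A))
        (swap \<Gamma> A B) (osub1 (ext C \<Gamma> B) (osub1 \<Gamma> B A) (osub1 \<Gamma> B A))
        (pr2 C (ext C \<Gamma> B) (osub1 \<Gamma> B A)) =
      msub C (ext C (ext C \<Gamma> A) (osub1 \<Gamma> A B)) (ext C \<Gamma> A) (pr1 C (ext C \<Gamma> A) (osub1 \<Gamma> A B))
        (osub1 \<Gamma> A A) (pr2 C \<Gamma> A)"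
    and lift_swap: "cmp C (ext C (ext C \<Gamma> A) (osub1 \<Gamma> A B)) (ext C (ext C \<Gamma> B) (osub1 \<Gamma> B A))
        (ext C \<Gamma> A) (lift (ext C \<Gamma> B) \<Gamma> A (pr1 C \<Gamma> B)) (swap \<Gamma> A B) =
      pr1 C (ext C \<Gamma> A) (osub1 \<Gamma> A B)"
proof -
  let ?GA = "ext C \<Gamma> A" and ?GB = "ext C \<Gamma> B" and ?B = "osub1 \<Gamma> A B" and ?A = "osub1 \<Gamma> B A"
  let ?E = "ext C ?GA ?B" and ?E' = "ext C ?GB ?A"
  have GA: "?GA \<in> obj C" and pA: "pr1 C \<Gamma> A \<in> hom C ?GA \<Gamma>"
    and GB: "?GB \<in> obj C" and pB: "pr1 C \<Gamma> B \<in> hom C ?GB \<Gamma>"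
    using \<Gamma> A B by simp_all
  note lA = lift_in[OF GA \<Gamma> B pA osub1_def] and pr1_lA = pr1_lift[OF GA \<Gamma> B pA osub1_def]
  note ty = \<Gamma> A B lA
  let ?g = "msub C ?E ?GA (pr1 C ?GA ?B) (osub1 \<Gamma> A A) (pr2 C \<Gamma> A)"
  have g: "?g \<in> dmor C ?E (osub C ?E ?GB (lift ?GA \<Gamma> B (pr1 C \<Gamma> A)) ?A)"
    using ty by (intro msub_in') (simp_all add: pr1_lA)
  show s: "swap \<Gamma> A B \<in> hom C ?E ?E'"
    and s1: "cmp C ?E ?E' ?GB (pr1 C ?GB ?A) (swap \<Gamma> A B) = lift ?GA \<Gamma> B (pr1 C \<Gamma> A)"
    and s2: "msub C ?E ?E' (swap \<Gamma> A B) (osub1 ?GB ?A ?A) (pr2 C ?GB ?A) = ?g"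
    using ty g by (simp_all add: swap_def Let_def)
  note lB = lift_in[OF GB \<Gamma> A pB osub1_def]
  show "cmp C ?E ?E' ?GA (lift ?GB \<Gamma> A (pr1 C \<Gamma> B)) (swap \<Gamma> A B) = pr1 C ?GA ?B"
  proof (rule ext_eqI[of ?E \<Gamma> A])
    show "cmp C ?E ?GA \<Gamma> (pr1 C \<Gamma> A) (cmp C ?E ?E' ?GA (lift ?GB \<Gamma> A (pr1 C \<Gamma> B)) (swap \<Gamma> A B)) =
        cmp C ?E ?GA \<Gamma> (pr1 C \<Gamma> A) (pr1 C ?GA ?B)"
      using ty s by (simp add: pr1_lift_cmp[OF _ GB \<Gamma> A pB osub1_def] s1 pr1_lA)
    show "msub C ?E ?GA (cmp C ?E ?E' ?GA (lift ?GB \<Gamma> A (pr1 C \<Gamma> B)) (swap \<Gamma> A B))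
        (osub1 \<Gamma> A A) (pr2 C \<Gamma> A) = ?g"
      using ty s by (simp add: pr2_lift_cmp[OF _ GB \<Gamma> A pB osub1_def] s2)
  qed (use ty s lB in simp_all)
qed

text \<open>In the first component, pi_1 after the outer exchange is a lift of pi_1, which
  \<open>lift_swap\<close> turns back into pi_1. As A and B are arbitrary, the other inverse law is
  an instance.\<close>

lemma swap_swap:
  assumes \<Gamma>: "\<Gamma> \<in> obj C" and A: "A \<in> dobj C \<Gamma>" and B: "B \<in> dobj C \<Gamma>"
  shows "cmp C (ext C (ext C \<Gamma> A) (osub1 \<Gamma> A B)) (ext C (ext C \<Gamma> B) (osub1 \<Gamma> B A))
      (ext C (ext C \<Gamma> A) (osub1 \<Gamma> A B)) (swap \<Gamma> B A) (swap \<Gamma> A B) =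
    ide C (ext C (ext C \<Gamma> A) (osub1 \<Gamma> A B))"
proof -
  let ?GA = "ext C \<Gamma> A" and ?GB = "ext C \<Gamma> B" and ?B = "osub1 \<Gamma> A B" and ?A = "osub1 \<Gamma> B A"
  let ?E = "ext C ?GA ?B" and ?E' = "ext C ?GB ?A"
  have GA: "?GA \<in> obj C" and pA: "pr1 C \<Gamma> A \<in> hom C ?GA \<Gamma>"
    using \<Gamma> A by simp_all
  note ty = \<Gamma> A B swap_in[OF \<Gamma> A B] swap_in[OF \<Gamma> B A]
  have "cmp C ?E ?E' ?GA (cmp C ?E' ?E ?GA (pr1 C ?GA ?B) (swap \<Gamma> B A)) (swap \<Gamma> A B) =
      pr1 C ?GA ?B"
    by (simp add: pr1_swap[OF \<Gamma> B A] lift_swap[OF \<Gamma> A B])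
  moreover have "msub C ?E ?E (cmp C ?E ?E' ?E (swap \<Gamma> B A) (swap \<Gamma> A B)) (osub1 ?GA ?B ?B)
      (pr2 C ?GA ?B) = pr2 C ?GA ?B"
  proof -
    have "msub C ?E ?E (cmp C ?E ?E' ?E (swap \<Gamma> B A) (swap \<Gamma> A B)) (osub1 ?GA ?B ?B) (pr2 C ?GA ?B) =
        msub C ?E ?E' (swap \<Gamma> A B) (osub C ?E' ?E (swap \<Gamma> B A) (osub1 ?GA ?B ?B))
          (msub C ?E' ?GB (pr1 C ?GB ?A) (osub1 \<Gamma> B B) (pr2 C \<Gamma> B))"
      using ty by (subst msub_cmp) (simp_all add: pr2_swap[OF \<Gamma> B A])
    also have "\<dots> = msub C ?E ?GB (lift ?GA \<Gamma> B (pr1 C \<Gamma> A)) (osub1 \<Gamma> B B) (pr2 C \<Gamma> B)"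
      using ty lift_in[OF \<Gamma>[THEN ext_in[OF _ B]] \<Gamma> A _ osub1_def]
      by (subst msub_msub)
        (simp_all add: pr1_swap[OF \<Gamma> A B] pr1_swap[OF \<Gamma> B A] pr1_lift[OF _ \<Gamma> A _ osub1_def])
    also have "\<dots> = pr2 C ?GA ?B"
      by (rule pr2_lift[OF GA \<Gamma> B pA osub1_def])
    finally show ?thesis .
  qed
  ultimately show ?thesis
    using ty by (intro ext_eqI[of ?E ?GA ?B _ "ide C ?E"]) (simp_all add: cmp_assoc)
qed

end

section \<open>Currying over \<Gamma>.A and the functor \<Pi>(B,_)\<close>

context cccwd
begin

context
  fixes \<Gamma> B X
  assumes \<Gamma>: "\<Gamma> \<in> obj C" and B: "B \<in> dobj C \<Gamma>" and X: "X \<in> dobj C (ext C \<Gamma> B)"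
begin

private abbreviation (input) "PBX \<equiv> PiD C \<Gamma> B X"
private abbreviation (input) "cur A \<equiv> wk_curry \<Gamma> A B X (PiD C \<Gamma> B X) (dev C \<Gamma> B X)"

lemma Pi_in: "PBX \<in> dobj C \<Gamma>"
  using pi[OF \<Gamma> B X] by (simp add: is_pi_def is_pseudo_pi_def)

lemma dev_in: "dev C \<Gamma> B X \<in> dmor C (ext C (ext C \<Gamma> PBX) (osub1 \<Gamma> PBX B)) (wk_cod \<Gamma> PBX B X)"
  using pi[OF \<Gamma> B X] by (simp add: is_pi_def is_pseudo_pi_def wk_cod_def)

lemma wk_cod_in:
  assumes "A \<in> dobj C \<Gamma>"
  shows "wk_cod \<Gamma> A B X \<in> dobj C (ext C (ext C \<Gamma> A) (osub1 \<Gamma> A B))"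
  using \<Gamma> B X assms lift_in[OF _ \<Gamma> B _ osub1_def, of A] by (simp add: wk_cod_def)

text \<open>Morphisms of C_\<Gamma> from A to \<Pi>(B,X) live over \<Gamma>.A, so the bijection is
  that of the weakened space \<Pi>(B,X){pi_1}, which \<open>is_pi\<close> requires to be a
  pseudo-\<Pi>-space.\<close>

lemma bij_betw_wk_curry:
  assumes "A \<in> dobj C \<Gamma>"
  shows "bij_betw (cur A) (dmor C (ext C (ext C \<Gamma> A) (osub1 \<Gamma> A B)) (wk_cod \<Gamma> A B X))
    (dmor C (ext C \<Gamma> A) (osub1 \<Gamma> A PBX))"
  unfolding wk_curry_def
proof (rule bij_betw_curry)
  show "is_pseudo_pi (ext C \<Gamma> A) (osub1 \<Gamma> A B) (wk_cod \<Gamma> A B X) (osub1 \<Gamma> A PBX)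
      (wk_dev \<Gamma> A B X PBX (dev C \<Gamma> B X))"
    using pi[OF \<Gamma> B X] assms by (simp add: is_pi_def)
qed (use \<Gamma> B X assms wk_cod_in in simp_all)

lemma wk_curry_in:
  assumes "A \<in> dobj C \<Gamma>" "h \<in> dmor C (ext C (ext C \<Gamma> A) (osub1 \<Gamma> A B)) (wk_cod \<Gamma> A B X)"
  shows "cur A h \<in> dmor C (ext C \<Gamma> A) (osub1 \<Gamma> A PBX)"
  using bij_betw_wk_curry[OF assms(1)] assms(2) by (auto simp: bij_betw_def)

lemma
  assumes "A \<in> dobj C \<Gamma>" "h \<in> dmor C (ext C (ext C \<Gamma> A) (osub1 \<Gamma> A B)) (wk_cod \<Gamma> A B X)"
  shows dev_wk_curry: "msub C (ext C (ext C \<Gamma> A) (osub1 \<Gamma> A B)) (ext C (ext C \<Gamma> PBX) (osub1 \<Gamma> PBX B))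
      (lift (ext C \<Gamma> A) (ext C \<Gamma> PBX) (osub1 \<Gamma> PBX B) (total \<Gamma> A PBX (cur A h)))
      (wk_cod \<Gamma> PBX B X) (dev C \<Gamma> B X) = h"
    and wk_curry_natural: "\<lbrakk>A' \<in> dobj C \<Gamma>; g \<in> dmor C (ext C \<Gamma> A') (osub1 \<Gamma> A' A)\<rbrakk> \<Longrightarrow>
      msub C (ext C \<Gamma> A') (ext C \<Gamma> A) (total \<Gamma> A' A g) (osub1 \<Gamma> A PBX) (cur A h) =
      cur A' (msub C (ext C (ext C \<Gamma> A') (osub1 \<Gamma> A' B)) (ext C (ext C \<Gamma> A) (osub1 \<Gamma> A B))
        (lift (ext C \<Gamma> A') (ext C \<Gamma> A) (osub1 \<Gamma> A B) (total \<Gamma> A' A g)) (wk_cod \<Gamma> A B X) h)"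
proof -
  note nat = pi[OF \<Gamma> B X, unfolded is_pi_def Let_def, THEN conjunct2,
      THEN bspec, OF assms(1), THEN conjunct2, THEN bspec, THEN bspec, OF _ assms(2), THEN bspec]
  show "msub C (ext C (ext C \<Gamma> A) (osub1 \<Gamma> A B)) (ext C (ext C \<Gamma> PBX) (osub1 \<Gamma> PBX B))
      (lift (ext C \<Gamma> A) (ext C \<Gamma> PBX) (osub1 \<Gamma> PBX B) (total \<Gamma> A PBX (cur A h)))
      (wk_cod \<Gamma> PBX B X) (dev C \<Gamma> B X) = h"
    \<comment> \<open>In \<open>is_pi\<close> the evaluation equation stands under the quantifiers
      over Y and g; the identity pi_2 of A is a g that always exists.\<close>
    using nat[of A "pr2 C \<Gamma> A"] \<Gamma> assms(1) by (simp add: total_def)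
  show "msub C (ext C \<Gamma> A') (ext C \<Gamma> A) (total \<Gamma> A' A g) (osub1 \<Gamma> A PBX) (cur A h) =
      cur A' (msub C (ext C (ext C \<Gamma> A') (osub1 \<Gamma> A' B)) (ext C (ext C \<Gamma> A) (osub1 \<Gamma> A B))
        (lift (ext C \<Gamma> A') (ext C \<Gamma> A) (osub1 \<Gamma> A B) (total \<Gamma> A' A g)) (wk_cod \<Gamma> A B X) h)"
    if "A' \<in> dobj C \<Gamma>" "g \<in> dmor C (ext C \<Gamma> A') (osub1 \<Gamma> A' A)"
    using nat[OF that] by (simp add: total_def)
qed

end

text \<open>The transpose of k : A{pi_1} -> X is \<Lambda>_A(k{swap}). Both sides of naturality turn
  out to be \<Lambda> of the same substitution instance of v.\<close>

lemma adjoint_weakening_Pi: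
  assumes \<Gamma>: "\<Gamma> \<in> obj C" and B: "B \<in> dobj C \<Gamma>"
  shows "adjoint (slice \<Gamma>) (slice (ext C \<Gamma> B)) (weakening_functor \<Gamma> B) (Pi_functor \<Gamma> B)"
proof (rule adjoint_rightI[where \<Phi> = "\<lambda>A X k. wk_curry \<Gamma> A B X (PiD C \<Gamma> B X) (dev C \<Gamma> B X)
    (msub C (ext C (ext C \<Gamma> A) (osub1 \<Gamma> A B)) (ext C (ext C \<Gamma> B) (osub1 \<Gamma> B A)) (swap \<Gamma> A B)
      (osub1 (ext C \<Gamma> B) (osub1 \<Gamma> B A) X) k)"])
  let ?D = "ext C \<Gamma> B" and ?p = "pr1 C \<Gamma> B" and ?G = "\<lambda>A. ext C \<Gamma> A"
    and ?W = "osub1 \<Gamma> B" and ?P = "PiD C \<Gamma> B"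
  let ?GB = "\<lambda>A. ext C (?G A) (osub1 \<Gamma> A B)" and ?DA = "\<lambda>A. ext C ?D (?W A)"
  let ?l = "\<lambda>A. lift (?G A) \<Gamma> B (pr1 C \<Gamma> A)"
  have D: "?D \<in> obj C" and p: "?p \<in> hom C ?D \<Gamma>" using \<Gamma> B by simp_all
  have P_obj [simp]: "fobj (Pi_functor \<Gamma> B) X = ?P X" for X
    by (simp add: Pi_functor_def)
  have W_obj [simp]: "fobj (weakening_functor \<Gamma> B) X = ?W X" for X
    by (simp add: weakening_functor_def)
  note Pi_in [simp] = Pi_in[OF \<Gamma> B]
  have l: "?l A \<in> hom C (?GB A) ?D" if "A \<in> dobj C \<Gamma>" for A
    using \<Gamma> B that by (intro lift_in osub1_def) simp_all
  have pr1_l: "cmp C (?GB A) ?D \<Gamma> ?p (?l A) =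
      cmp C (?GB A) (?G A) \<Gamma> (pr1 C \<Gamma> A) (pr1 C (?G A) (osub1 \<Gamma> A B))" if "A \<in> dobj C \<Gamma>" for A
    using \<Gamma> B that by (intro pr1_lift osub1_def) simp_all
  have GB: "?GB A \<in> obj C" if "A \<in> dobj C \<Gamma>" for A
    using \<Gamma> B that by simp
  have cod_in: "wk_cod \<Gamma> A B X \<in> dobj C (?GB A)" if "A \<in> dobj C \<Gamma>" "X \<in> dobj C ?D" for A X
    using wk_cod_in[OF \<Gamma> B] that by simp
  have dev: "dev C \<Gamma> B X \<in> dmor C (?GB (?P X)) (osub C (?GB (?P X)) ?D (?l (?P X)) X)"
    if "X \<in> dobj C ?D" for X
    using dev_in[OF \<Gamma> B that] by (simp add: wk_cod_def)
  let ?e = "\<lambda>X. pair (?GB (?P X)) ?D X (?l (?P X)) (dev C \<Gamma> B X)"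
  have e: "?e X \<in> hom C (?GB (?P X)) (ext C ?D X)" if "X \<in> dobj C ?D" for X
    using \<Gamma> B that l dev by simp
  \<comment> \<open>This is \<Pi>(B,v) before currying: v substituted along the pair of the
    projection to \<Gamma>.B and \<open>dev\<close>.\<close>
  have Pv: "msub C (?GB (?P X)) (ext C ?D X) (?e X) (osub1 ?D X X') v \<in>
      dmor C (?GB (?P X)) (wk_cod \<Gamma> (?P X) B X')"
    if "X \<in> dobj C ?D" "X' \<in> dobj C ?D" "v \<in> dmor C (ext C ?D X) (osub1 ?D X X')" for X X' v
    using \<Gamma> B that l dev e by (intro msub_in') (simp_all add: wk_cod_def)
  have fmor_P: "fmor (Pi_functor \<Gamma> B) X X' v = wk_curry \<Gamma> (?P X) B X' (?P X') (dev C \<Gamma> B X')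
      (msub C (?GB (?P X)) (ext C ?D X) (?e X) (osub1 ?D X X') v)" for X X' v
    by (simp add: Pi_functor_def Let_def)
  have ty_s: "wk_cod \<Gamma> A B X = osub C (?GB A) (?DA A) (swap \<Gamma> A B) (osub1 ?D (?W A) X)"
    if "A \<in> dobj C \<Gamma>" "X \<in> dobj C ?D" for A X
    using \<Gamma> B that swap_in[OF \<Gamma> that(1) B] by (simp add: wk_cod_def pr1_swap[OF \<Gamma> that(1) B])
  show "is_functor (slice \<Gamma>) (slice ?D) (weakening_functor \<Gamma> B)"
    unfolding weakening_functor_eq by (rule is_functor_reindex[OF D \<Gamma> p])
  show "fobj (Pi_functor \<Gamma> B) X \<in> obj (slice \<Gamma>)" if "X \<in> obj (slice ?D)" for X
    using that by simp
  show "fmor (Pi_functor \<Gamma> B) X X' v \<in>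
      hom (slice \<Gamma>) (fobj (Pi_functor \<Gamma> B) X) (fobj (Pi_functor \<Gamma> B) X')"
    if "X \<in> obj (slice ?D)" "X' \<in> obj (slice ?D)" "v \<in> hom (slice ?D) X X'" for X X' v
    using that by (simp add: fmor_P wk_curry_in[OF \<Gamma> B] Pv)
  {
    fix A X assume "A \<in> obj (slice \<Gamma>)" "X \<in> obj (slice ?D)"
    then have A: "A \<in> dobj C \<Gamma>" and X: "X \<in> dobj C ?D" by simp_all
    have "bij_betw (msub C (?GB A) (?DA A) (swap \<Gamma> A B) (osub1 ?D (?W A) X))
        (dmor C (?DA A) (osub1 ?D (?W A) X)) (dmor C (?GB A) (wk_cod \<Gamma> A B X))"
      by (rule bij_betw_msub[where v = "swap \<Gamma> B A"])
        (use \<Gamma> B A X swap_in[OF \<Gamma> A B] swap_in[OF \<Gamma> B A] swap_swap[OF \<Gamma> A B] swap_swap[OF \<Gamma> B A]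
          ty_s[OF A X] in simp_all)
    from bij_betw_trans[OF this bij_betw_wk_curry[OF \<Gamma> B X A]]
    show "bij_betw (\<lambda>k. wk_curry \<Gamma> A B X (?P X) (dev C \<Gamma> B X)
        (msub C (?GB A) (?DA A) (swap \<Gamma> A B) (osub1 ?D (?W A) X) k))
      (hom (slice ?D) (fobj (weakening_functor \<Gamma> B) A) X) (hom (slice \<Gamma>) A (fobj (Pi_functor \<Gamma> B) X))"
      by (simp add: comp_def)
  }
  fix A A' X X' u v k
  assume "A \<in> obj (slice \<Gamma>)" "A' \<in> obj (slice \<Gamma>)" "X \<in> obj (slice ?D)" "X' \<in> obj (slice ?D)"
    "u \<in> hom (slice \<Gamma>) A' A" "v \<in> hom (slice ?D) X X'"
    "k \<in> hom (slice ?D) (fobj (weakening_functor \<Gamma> B) A) X"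
  then have A: "A \<in> dobj C \<Gamma>" and A': "A' \<in> dobj C \<Gamma>"
    and X: "X \<in> dobj C ?D" and X': "X' \<in> dobj C ?D"
    and u: "u \<in> dmor C (?G A') (osub1 \<Gamma> A' A)"
    and v: "v \<in> dmor C (ext C ?D X) (osub1 ?D X X')"
    and k: "k \<in> dmor C (?DA A) (osub1 ?D (?W A) X)"
    by simp_all
  let ?s = "swap \<Gamma> A B" and ?s' = "swap \<Gamma> A' B"
  let ?Wu = "fmor (weakening_functor \<Gamma> B) A' A u"
  let ?curry = "\<lambda>A X. wk_curry \<Gamma> A B X (?P X) (dev C \<Gamma> B X)"
  let ?u = "total \<Gamma> A' A u"
  let ?lu = "lift (?G A') (?G A) (osub1 \<Gamma> A B) ?u"
  let ?h = "msub C (?GB A) (?DA A) ?s (osub1 ?D (?W A) X) k"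
  let ?h' = "msub C (?GB A') (?GB A) ?lu (wk_cod \<Gamma> A B X) ?h"
  let ?c = "?curry A' X ?h'"
  let ?lc = "lift (?G A') (?G (?P X)) (osub1 \<Gamma> (?P X) B) (total \<Gamma> A' (?P X) ?c)"
  have Wu: "?Wu \<in> dmor C (?DA A') (osub1 ?D (?W A') (?W A))"
    and square: "cmp C (?DA A') (?DA A) (?G A) (lift ?D \<Gamma> A ?p) (total ?D (?W A') (?W A) ?Wu) =
      cmp C (?DA A') (?G A') (?G A) ?u (lift ?D \<Gamma> A' ?p)"
    unfolding weakening_functor_eq
    using reindex_in[OF D \<Gamma> p A' A u] lift_total_reindex[OF D \<Gamma> p A' A u]
    by (simp_all add: osub1_def[of \<Gamma> B])
  \<comment> \<open>Used for two morphisms of C_\<Gamma> out of A': u into A, and the curried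
    \<open>?c\<close> into \<Pi>(B,X). As <pi_1,g> lies over \<Gamma>, its lift along B commutes
    with the projections to \<Gamma>.B.\<close>
  have lift_total: "lift (?G A') (?G Y) (osub1 \<Gamma> Y B) (total \<Gamma> A' Y g) \<in> hom C (?GB A') (?GB Y)"
    "cmp C (?GB A') (?GB Y) ?D (?l Y) (lift (?G A') (?G Y) (osub1 \<Gamma> Y B) (total \<Gamma> A' Y g)) = ?l A'"
    "cmp C (?GB A') (?GB Y) (?G Y) (pr1 C (?G Y) (osub1 \<Gamma> Y B))
      (lift (?G A') (?G Y) (osub1 \<Gamma> Y B) (total \<Gamma> A' Y g)) =
      cmp C (?GB A') (?G A') (?G Y) (total \<Gamma> A' Y g) (pr1 C (?G A') (osub1 \<Gamma> A' B))"
    if Y: "Y \<in> dobj C \<Gamma>" and g: "g \<in> dmor C (?G A') (osub1 \<Gamma> A' Y)" for Y g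
  proof -
    have eq: "osub1 \<Gamma> A' B = osub C (?G A') (?G Y) (total \<Gamma> A' Y g) (osub1 \<Gamma> Y B)"
      using \<Gamma> B A' Y g by (simp add: osub_total del: osub_osub1)
    have GA': "?G A' \<in> obj C" and GY: "?G Y \<in> obj C" and BY: "osub1 \<Gamma> Y B \<in> dobj C (?G Y)"
      and t: "total \<Gamma> A' Y g \<in> hom C (?G A') (?G Y)" and pY: "pr1 C \<Gamma> Y \<in> hom C (?G Y) \<Gamma>"
      using \<Gamma> B A' Y g by simp_all
    show "lift (?G A') (?G Y) (osub1 \<Gamma> Y B) (total \<Gamma> A' Y g) \<in> hom C (?GB A') (?GB Y)"
      by (rule lift_in[OF GA' GY BY t eq])
    show "cmp C (?GB A') (?GB Y) ?D (?l Y) (lift (?G A') (?G Y) (osub1 \<Gamma> Y B) (total \<Gamma> A' Y g)) =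
        ?l A'"
      using lift_cmp[OF GA' GY \<Gamma> B pY t osub1_def eq] \<Gamma> A' Y g by simp
    show "cmp C (?GB A') (?GB Y) (?G Y) (pr1 C (?G Y) (osub1 \<Gamma> Y B))
      (lift (?G A') (?G Y) (osub1 \<Gamma> Y B) (total \<Gamma> A' Y g)) =
      cmp C (?GB A') (?G A') (?G Y) (total \<Gamma> A' Y g) (pr1 C (?G A') (osub1 \<Gamma> A' B))"
      by (rule pr1_lift[OF GA' GY BY t eq])
  qed
  note s = swap_in[OF \<Gamma> A B] and s' = swap_in[OF \<Gamma> A' B]
  note lu = lift_total[OF A u]
  note ty = \<Gamma> B D A A' X X' u v k Wu s s' GB lu(1) l cod_in
  have h: "?h \<in> dmor C (?GB A) (wk_cod \<Gamma> A B X)"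
    using ty by (intro msub_in' ty_s) simp_all
  have cod_lu: "wk_cod \<Gamma> A' B Y = osub C (?GB A') (?GB A) ?lu (wk_cod \<Gamma> A B Y)"
    if "Y \<in> dobj C ?D" for Y
    using ty that by (simp add: wk_cod_def lu)
  have h': "?h' \<in> dmor C (?GB A') (wk_cod \<Gamma> A' B X)"
    using ty by (intro msub_in'[OF _ _ _ _ h cod_lu]) simp_all
  have c: "?c \<in> dmor C (?G A') (osub1 \<Gamma> A' (?P X))"
    by (rule wk_curry_in[OF \<Gamma> B X A' h'])
  note lc = lift_total[OF Pi_in[OF X] c]
  \<comment> \<open>Naturality in A: the transpose of k composed with u is the single curried
    \<open>?c\<close>, so only the variation in X remains.\<close>
  have nat_u: "msub C (?G A') (?G A) ?u (osub1 \<Gamma> A (?P X)) (?curry A X ?h) = ?c"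
    by (rule wk_curry_natural[OF \<Gamma> B X A h A' u])
  \<comment> \<open>The exchange is natural in A: weakening u by B on one side is lifting <pi_1,u>
    along B on the other.\<close>
  have swap_lift: "cmp C (?GB A') (?DA A') (?DA A) (total ?D (?W A') (?W A) ?Wu) ?s' =
      cmp C (?GB A') (?GB A) (?DA A) ?s ?lu"
  proof (rule ext_eqI[of "?GB A'" ?D "?W A"])
    show "cmp C (?GB A') (?DA A) ?D (pr1 C ?D (?W A))
        (cmp C (?GB A') (?DA A') (?DA A) (total ?D (?W A') (?W A) ?Wu) ?s') =
      cmp C (?GB A') (?DA A) ?D (pr1 C ?D (?W A)) (cmp C (?GB A') (?GB A) (?DA A) ?s ?lu)"
    proof -
      have "cmp C (?GB A') (?DA A) ?D (pr1 C ?D (?W A)) (cmp C (?GB A') (?GB A) (?DA A) ?s ?lu) = ?l A'"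
        using ty by (simp add: pr1_swap[OF \<Gamma> A B] lu flip: cmp_assoc)
      then show ?thesis
        using ty by (simp add: pr1_swap[OF \<Gamma> A' B])
    qed
    show "msub C (?GB A') (?DA A) (cmp C (?GB A') (?DA A') (?DA A) (total ?D (?W A') (?W A) ?Wu) ?s')
        (osub1 ?D (?W A) (?W A)) (pr2 C ?D (?W A)) =
      msub C (?GB A') (?DA A) (cmp C (?GB A') (?GB A) (?DA A) ?s ?lu)
        (osub1 ?D (?W A) (?W A)) (pr2 C ?D (?W A))"
    proof -
      note lA' = lift_in[OF D \<Gamma> A' p osub1_def] and pr1_lA' = pr1_lift[OF D \<Gamma> A' p osub1_def]
      have "msub C (?GB A') (?DA A) (cmp C (?GB A') (?DA A') (?DA A) (total ?D (?W A') (?W A) ?Wu) ?s')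
          (osub1 ?D (?W A) (?W A)) (pr2 C ?D (?W A)) =
        msub C (?GB A') (?DA A') ?s' (osub1 ?D (?W A') (?W A)) ?Wu"
        using ty by (simp add: pr2_total_cmp)
      \<comment> \<open>The weakening of u is u substituted along a lift of pi_1, and by
        \<open>lift_swap\<close> that lift after the exchange is pi_1.\<close>
      also have "\<dots> = msub C (?GB A') (?G A') (pr1 C (?G A') (osub1 \<Gamma> A' B)) (osub1 \<Gamma> A' A) u"
        using ty lA' unfolding weakening_functor_def
        by (simp, subst msub_msub) (simp_all add: lift_swap[OF \<Gamma> A' B] pr1_lA', simp add: osub1_def)
      also have "\<dots> = msub C (?GB A') (?G A) (cmp C (?GB A') (?GB A) (?G A)
          (pr1 C (?G A) (osub1 \<Gamma> A B)) ?lu) (osub1 \<Gamma> A A) (pr2 C \<Gamma> A)"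
        using ty by (simp add: lu pr2_total_cmp)
      also have "\<dots> = msub C (?GB A') (?DA A) (cmp C (?GB A') (?GB A) (?DA A) ?s ?lu)
        (osub1 ?D (?W A) (?W A)) (pr2 C ?D (?W A))"
        using ty by (simp add: msub_cmp pr2_swap[OF \<Gamma> A B] pr1_swap[OF \<Gamma> A B] pr1_l)
      finally show ?thesis .
    qed
  qed (use ty in simp_all)
  \<comment> \<open>The \<beta>-law \<open>dev_wk_curry\<close>: evaluating \<open>?c\<close>
    returns \<open>?h'\<close>, so the left-hand side is the pair of the projection to \<Gamma>.B
    and \<open>?h'\<close>. The right-hand side has the same components because \<open>?h'\<close>
    is k substituted along the exchange and the lift of u.\<close>
  have e_lc: "cmp C (?GB A') (?GB (?P X)) (ext C ?D X) (?e X) ?lc =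
      cmp C (?GB A') (?DA A) (ext C ?D X) (total ?D (?W A) X k) (cmp C (?GB A') (?GB A) (?DA A) ?s ?lu)"
  proof -
    have "cmp C (?GB A') (?GB (?P X)) (ext C ?D X) (?e X) ?lc = pair (?GB A') ?D X (?l A') ?h'"
      using ty dev[OF X] lc(1) dev_wk_curry[OF \<Gamma> B X A' h']
      by (subst pair_cmp) (simp_all add: lc wk_cod_def[of \<Gamma> "?P X" B X, symmetric])
    also have "\<dots> = cmp C (?GB A') (?DA A) (ext C ?D X) (total ?D (?W A) X k)
        (cmp C (?GB A') (?GB A) (?DA A) ?s ?lu)"
    proof (rule pair_unique)
      show "?h' \<in> dmor C (?GB A') (osub C (?GB A') ?D (?l A') X)"
        using h' by (simp add: wk_cod_def)
      show "cmp C (?GB A') (ext C ?D X) ?D (pr1 C ?D X) (cmp C (?GB A') (?DA A) (ext C ?D X)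
          (total ?D (?W A) X k) (cmp C (?GB A') (?GB A) (?DA A) ?s ?lu)) = ?l A'"
        using ty by (simp, simp add: pr1_swap[OF \<Gamma> A B] lu flip: cmp_assoc)
      show "msub C (?GB A') (ext C ?D X) (cmp C (?GB A') (?DA A) (ext C ?D X)
          (total ?D (?W A) X k) (cmp C (?GB A') (?GB A) (?DA A) ?s ?lu)) (osub1 ?D X X) (pr2 C ?D X) =
          ?h'"
        using ty by (simp add: pr2_total_cmp msub_msub[OF ty_s])
    qed (use ty in simp_all)
    finally show ?thesis .
  qed
  let ?Pv = "msub C (?GB (?P X)) (ext C ?D X) (?e X) (osub1 ?D X X') v"
  have vk: "msub C (?DA A') (?DA A) (total ?D (?W A') (?W A) ?Wu) (osub1 ?D (?W A) X) k \<in>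
      dmor C (?DA A') (osub1 ?D (?W A') X)"
    using ty by simp
  have "msub C (?GB A') (?DA A') ?s' (osub1 ?D (?W A') X')
      (msub C (?DA A') (ext C ?D X) (total ?D (?W A') X
        (msub C (?DA A') (?DA A) (total ?D (?W A') (?W A) ?Wu) (osub1 ?D (?W A) X) k))
        (osub1 ?D X X') v) =
    msub C (?GB A') (ext C ?D X) (cmp C (?GB A') (?DA A) (ext C ?D X) (total ?D (?W A) X k)
      (cmp C (?GB A') (?DA A') (?DA A) (total ?D (?W A') (?W A) ?Wu) ?s')) (osub1 ?D X X') v"
    using ty by (subst msub_msub)
      (simp_all add: total_slice_cmp cmp_assoc osub1_def[of ?D "?W A'"])
  also have "\<dots> = msub C (?GB A') (?GB (?P X)) ?lc (wk_cod \<Gamma> (?P X) B X') ?Pv"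
    using ty e[OF X] lc(1) dev[OF X] unfolding swap_lift e_lc[symmetric]
    by (subst msub_msub) (simp_all add: wk_cod_def)
  \<comment> \<open>The substitution law of \<Lambda> once more, now for X' and along
    \<open>?c\<close>, pulls the substitution out of the currying.\<close>
  finally have "?curry A' X' (msub C (?GB A') (?DA A') ?s' (osub1 ?D (?W A') X')
      (msub C (?DA A') (ext C ?D X) (total ?D (?W A') X
        (msub C (?DA A') (?DA A) (total ?D (?W A') (?W A) ?Wu) (osub1 ?D (?W A) X) k))
        (osub1 ?D X X') v)) =
    msub C (?G A') (?G (?P X)) (total \<Gamma> A' (?P X) ?c) (osub1 \<Gamma> (?P X) (?P X'))
      (?curry (?P X) X' ?Pv)"
    using wk_curry_natural[OF \<Gamma> B X' Pi_in[OF X] Pv[OF X X' v] A' c] by simp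
  then show "?curry A' X' (msub C (?GB A') (?DA A') ?s' (osub1 ?D (?W A') X')
      (cmp (slice ?D) (fobj (weakening_functor \<Gamma> B) A') X X' v
        (cmp (slice ?D) (fobj (weakening_functor \<Gamma> B) A') (fobj (weakening_functor \<Gamma> B) A) X k ?Wu))) =
    cmp (slice \<Gamma>) A' (fobj (Pi_functor \<Gamma> B) X) (fobj (Pi_functor \<Gamma> B) X')
      (fmor (Pi_functor \<Gamma> B) X X' v)
      (cmp (slice \<Gamma>) A' A (fobj (Pi_functor \<Gamma> B) X) (?curry A X ?h) u)"
    by (simp add: fmor_P nat_u)
qed

end

theorem mainTheorem8:
  fixes C :: "('o, 'm, 'd, 'e, 'z) cccwd_scheme" and \<Gamma> :: 'o and B :: 'd
  assumes "cccwd C" and "\<Gamma> \<in> obj C" and "B \<in> dobj C \<Gamma>"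
  defines "C\<^sub>\<Gamma> \<equiv> sccwd.slice C \<Gamma>"
    and "C\<^sub>\<Gamma>\<^sub>B \<equiv> sccwd.slice C (ext C \<Gamma> B)"
    and "W \<equiv> cccwd.weakening_functor C \<Gamma> B"
    and "S \<equiv> cccwd.Sigma_functor C \<Gamma> B"
    and "P \<equiv> cccwd.Pi_functor C \<Gamma> B"
  shows "is_functor C\<^sub>\<Gamma> C\<^sub>\<Gamma>\<^sub>B W \<and> is_functor C\<^sub>\<Gamma>\<^sub>B C\<^sub>\<Gamma> S \<and> is_functor C\<^sub>\<Gamma>\<^sub>B C\<^sub>\<Gamma> P \<and>
    adjoint C\<^sub>\<Gamma>\<^sub>B C\<^sub>\<Gamma> S W \<and> adjoint C\<^sub>\<Gamma> C\<^sub>\<Gamma>\<^sub>B W P \<and>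
    adjoint C\<^sub>\<Gamma>\<^sub>B C\<^sub>\<Gamma>\<^sub>B (functor_comp W S) (functor_comp W P)"
proof -
  interpret cccwd C by fact
  have SW: "adjoint C\<^sub>\<Gamma>\<^sub>B C\<^sub>\<Gamma> S W" and WP: "adjoint C\<^sub>\<Gamma> C\<^sub>\<Gamma>\<^sub>B W P"
    unfolding C\<^sub>\<Gamma>_def C\<^sub>\<Gamma>\<^sub>B_def W_def S_def P_def
    using assms(2,3) by (rule adjoint_Sigma_weakening, rule adjoint_weakening_Pi)
  \<comment> \<open>In the composed adjunction the left adjoint is S followed by W and the right
    adjoint is P followed by W, that is X |-> \<Pi>(B,X){pi_1}; both run from the category over
    \<Gamma>.B to itself.\<close>
  then show ?thesis
    using adjoint_comp[OF SW WP] by (simp add: adjoint_def)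
qed

end
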